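(* The family of value functions $(u_n)_{0\le n\le N}$ defined by $$u_{n}(x,q,S,A)= \sup_{(v,n^{\star})\in\mathcal{A}_{n}}\mathbb{E}\left[-\exp\left(-\gamma\left(F-X_{n^{\star}}^{n,x,v}-\left(\frac{F}{A^{n,A,S}_{n^{\star}}}- q^{n,q,v}_{n^{\star}}\right)S^{n,S}_{n^{\star}} - \ell\left(\frac{F}{A^{n,A,S}_{n^{\star}}}- q^{n,q,v}_{n^{\star}}\right)\right)\right)\right]$$ is the unique solution of the Bellman equation $$u_{n}(x,q,S,A)=\begin{cases} -\exp\left(-\gamma\left(F-x-\left(\frac{F}{A}- q\right)S - \ell\left(\frac{F}{A}- q\right)\right)\right) & \text{if } n=N,\\[1mm] \max\Big\{\tilde{u}_{n,n+1}(x,q,S,A),\; -\exp\left(-\gamma\left(F-x-\left(\frac{F}{A}- q\right)S - \ell\left(\frac{F}{A}- q\right)\right)\right)\Big\} & \text{if } n\in\mathcal{N},\\[1mm] \tilde{u}_{n,n+1}(x,q,S,A) & \text{otherwise}, \end{cases}$$ where $$\tilde{u}_{n,n+1}(x,q,S,A) = \sup_{\underline{\rho} V_{n+1}\le v \le \overline{\rho} V_{n+1}}\mathbb{E}\left[u_{n+1}\Big(X_{n+1}^{n,x,v},q_{n+1}^{n,q,v},S_{n+1}^{n,S},A_{n+1}^{n,A,S}\Big)\right].$$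
   Context: Setting. Discrete-time model with time indices $0,\dots,N$ and time step $\delta t>0$. Let $(\Omega,(\mathcal{F}_n)_{0\le n\le N},\mathbb{P})$ be a filtered probability space whose filtration satisfies the usual assumptions; all random variables are defined on it. The random variables $(\epsilon_n)_n$ are i.i.d. with mean $0$, variance $1$ and a moment-generating function defined on $\mathbb{R}_+$, and $\epsilon_{n+1}$ is $\mathcal{F}_{n+1}$-measurable. $\sigma>0$ is the volatility parameter, $F>0$ the notional of the contract, $\gamma>0$ the absolute risk aversion parameter. The market volume process $(V_n)_n$ ($V_{n+1}\delta t$ is the market volume over the period between time indices $n$ and $n+1$) is $\mathcal{F}_0$-measurable. $\underline{\rho},\overline{\rho}$ are bounds on the participation rate ($\underline{\rho}$ can be of either sign). $\mathcal{N}\subset\{1,\dots,N-1\}$ is a non-empty set (time indices at which the option can be exercised early). The execution cost function $L:\mathbb{R}\to\mathbb{R}_+$ is continuous, strictly convex, even, increasing on $\mathbb{R}_+$, with $L(0)=0$ and $\lim_{\rho\to+\infty}L(\rho)/\rho=+\infty$. The penalty function is $\ell(q)=\frac{L(\rho)}{\rho}|q|+\frac{\gamma\sigma^2}{6\rho V}|q|^3$, where $\rho$ is a constant participation rate and $V$ is the average value of the market volume process. State variables. For $0\le n\le k\le N$ and $k>0$: $$X_{k}^{n,x,v}=x+\sum_{j=n}^{k-1}\left(v_{j}S_{j+1}^{n,S}\delta t+L\left(\tfrac{v_{j}}{V_{j+1}}\right)V_{j+1}\delta t\right),\qquad q_{k}^{n,q,v}=q+\sum_{j=n}^{k-1}v_{j}\delta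 t,$$ $$S_{k}^{n,S}=S+\sigma\sqrt{\delta t}\sum_{j=n}^{k-1}\epsilon_{j+1},\qquad A_{k}^{n,A,S}=\frac{n}{k}A+\frac{1}{k}\sum_{j=n}^{k-1}S_{j+1}^{n,S}.$$ In the definition of $\tilde u_{n,n+1}$, $X_{n+1}^{n,x,v}$ and $q_{n+1}^{n,q,v}$ are taken with $v_n=v$. Admissible strategies. $\mathcal{A}_n$ is the set of pairs $(v,n^\star)$ where $v=(v_k)_{n\le k\le n^\star-1}$ is $(\mathcal{F})$-adapted with $\underline{\rho}V_{k+1}\le v_k\le\overline{\rho}V_{k+1}$, and $n^\star$ is an $(\mathcal{F})$-stopping time taking values in $(\mathcal{N}\cup\{N\})\cap\{n,\dots,N\}$. When $n=0$, the function $u_n$ is independent of $A$.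
   Formalization: Added: each ε_{n+1} is independent of F_n (else strategies could anticipate prices and the Bellman equation fails), and each V_n is almost surely a positive constant (else the bounds on v make the right-hand side random); F/A is read as 0 when A = 0. *)

theory Defs
  imports "HOL-Probability.Probability"
begin

text \<open>
  Time indices are natural numbers; only \<open>0, \<dots>, horizon m\<close> matter.
  \<open>volume m (Suc n) \<omega> * dt m\<close> is the market volume traded between \<open>n\<close> and \<open>Suc n\<close>, and
  \<open>noise m (Suc n)\<close> drives the price over the same period.
\<close>

record 'a asr_model =
  prob_sp :: "'a measure"                    (* (\<Omega>, P) *)
  filt :: "nat \<Rightarrow> 'a measure"                (* F_n *)
  horizon :: nat                             (* N *)
  dt :: real                                 (* \<delta>t *)
  noise :: "nat \<Rightarrow> 'a \<Rightarrow> real"               (* \<epsilon>_n *)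
  volume :: "nat \<Rightarrow> 'a \<Rightarrow> real"              (* V_n *)
  volat :: real                              (* \<sigma> *)
  notional :: real                           (* F *)
  aversion :: real                           (* \<gamma> *)
  rho_min :: real                            (* lower bound on v / V *)
  rho_max :: real                            (* upper bound on v / V *)
  early :: "nat set"                         (* the set of early exercise indices *)
  exec_cost :: "real \<Rightarrow> real"                (* L *)
  rho_pen :: real                            (* \<rho> in the penalty *)

definition strictly_convex :: "(real \<Rightarrow> real) \<Rightarrow> bool" where
  "strictly_convex f \<longleftrightarrow>
     (\<forall>x y t. x \<noteq> y \<and> 0 < t \<and> t < 1 \<longrightarrow>
        f ((1 - t) * x + t * y) < (1 - t) * f x + t * f y)"

definition execution_cost_function :: "(real \<Rightarrow> real) \<Rightarrow> bool" where
  "execution_cost_function L \<longleftrightarrow>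
     (\<forall>r. 0 \<le> L r) \<and> continuous_on UNIV L \<and> strictly_convex L \<and> (\<forall>r. L (- r) = L r) \<and>
     mono_on {0..} L \<and> L 0 = 0 \<and> filterlim (\<lambda>r. L r / r) at_top at_top"

definition average_volume :: "'a asr_model \<Rightarrow> real" where
  "average_volume m =
     (\<Sum>k = 1..horizon m. prob_space.expectation (prob_sp m) (volume m k)) / real (horizon m)"

definition penalty :: "'a asr_model \<Rightarrow> real \<Rightarrow> real" where
  "penalty m q =
     exec_cost m (rho_pen m) / rho_pen m * \<bar>q\<bar>
     + aversion m * (volat m)\<^sup>2 / (6 * rho_pen m * average_volume m) * \<bar>q\<bar> ^ 3"

text \<open>
  Two hypotheses below are implicit in the use of value functions and of a Bellman equation on
  deterministic states. The innovation \<open>noise m (Suc n)\<close> is independent of \<open>filt m n\<close>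
  (otherwise an adapted strategy could anticipate prices), and the volumes, which are known at
  time 0, are almost surely equal to positive constants (as is the case for every
  \<open>filt m 0\<close>-measurable variable when \<open>filt m 0\<close> is trivial).
  In discrete time the usual conditions reduce to completeness.
\<close>

locale asr_market =
  prob_space "prob_sp m" + filtration "space (prob_sp m)" "filt m"
  for m :: "'a asr_model" +
  assumes filt_le: "\<And>n. sets (filt m n) \<subseteq> sets (prob_sp m)"
    and filt_complete: "\<And>A B. A \<in> null_sets (prob_sp m) \<Longrightarrow> B \<subseteq> A \<Longrightarrow> B \<in> sets (filt m 0)"
    and early_nonempty: "early m \<noteq> {}"
    and early_subset: "early m \<subseteq> {1..horizon m - 1}"
    and noise_adapted: "\<And>k. k \<in> {1..horizon m} \<Longrightarrow> noise m k \<in> borel_measurable (filt m k)"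
    and noise_indep: "indep_vars (\<lambda>_. borel) (noise m) {1..horizon m}"
    and noise_ident: "\<And>j k. j \<in> {1..horizon m} \<Longrightarrow> k \<in> {1..horizon m} \<Longrightarrow>
           distr (prob_sp m) borel (noise m j) = distr (prob_sp m) borel (noise m k)"
    and noise_integrable: "\<And>k. k \<in> {1..horizon m} \<Longrightarrow> integrable (prob_sp m) (noise m k)"
    and noise_mean: "\<And>k. k \<in> {1..horizon m} \<Longrightarrow> expectation (noise m k) = 0"
    and noise_sq_integrable: "\<And>k. k \<in> {1..horizon m} \<Longrightarrow>
           integrable (prob_sp m) (\<lambda>\<omega>. (noise m k \<omega>)\<^sup>2)"
    and noise_variance: "\<And>k. k \<in> {1..horizon m} \<Longrightarrow> variance (noise m k) = 1"
    and noise_mgf: "\<And>k t. k \<in> {1..horizon m} \<Longrightarrow> 0 \<le> t \<Longrightarrow>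
           integrable (prob_sp m) (\<lambda>\<omega>. exp (t * noise m k \<omega>))"
    and noise_indep_past: "\<And>n. n < horizon m \<Longrightarrow>
           indep_set (sets (filt m n)) {noise m (Suc n) -` B \<inter> space (prob_sp m) | B. B \<in> sets borel}"
    and volume_measurable: "\<And>k. k \<in> {1..horizon m} \<Longrightarrow> volume m k \<in> borel_measurable (filt m 0)"
    and volume_known: "\<And>k. k \<in> {1..horizon m} \<Longrightarrow> \<exists>c>0. AE \<omega> in prob_sp m. volume m k \<omega> = c"
    and dt_pos: "dt m > 0"
    and volat_pos: "volat m > 0"
    and notional_pos: "notional m > 0"
    and aversion_pos: "aversion m > 0"
    and rho_bounds: "rho_min m \<le> rho_max m"
    and exec_cost: "execution_cost_function (exec_cost m)"
    and rho_pen_pos: "rho_pen m > 0"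

definition price :: "'a asr_model \<Rightarrow> nat \<Rightarrow> real \<Rightarrow> nat \<Rightarrow> 'a \<Rightarrow> real" where
  "price m n S k \<omega> = S + volat m * sqrt (dt m) * (\<Sum>j = n..<k. noise m (Suc j) \<omega>)"

definition cash ::
  "'a asr_model \<Rightarrow> (nat \<Rightarrow> 'a \<Rightarrow> real) \<Rightarrow> nat \<Rightarrow> real \<Rightarrow> real \<Rightarrow> nat \<Rightarrow> 'a \<Rightarrow> real" where
  "cash m v n x S k \<omega> = x +
     (\<Sum>j = n..<k. v j \<omega> * price m n S (Suc j) \<omega> * dt m
        + exec_cost m (v j \<omega> / volume m (Suc j) \<omega>) * volume m (Suc j) \<omega> * dt m)"

definition inventory ::
  "'a asr_model \<Rightarrow> (nat \<Rightarrow> 'a \<Rightarrow> real) \<Rightarrow> nat \<Rightarrow> real \<Rightarrow> nat \<Rightarrow> 'a \<Rightarrow> real" where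
  "inventory m v n q k \<omega> = q + (\<Sum>j = n..<k. v j \<omega> * dt m)"

definition avg_price :: "'a asr_model \<Rightarrow> nat \<Rightarrow> real \<Rightarrow> real \<Rightarrow> nat \<Rightarrow> 'a \<Rightarrow> real" where
  "avg_price m n A S k \<omega> =
     real n / real k * A + 1 / real k * (\<Sum>j = n..<k. price m n S (Suc j) \<omega>)"

text \<open>
  At \<open>A = 0\<close>, where \<open>F / A\<close> is mathematically undefined, \<open>notional m / A\<close> is 0 by the usual
  convention of HOL.
\<close>

definition exercise_utility :: "'a asr_model \<Rightarrow> real \<Rightarrow> real \<Rightarrow> real \<Rightarrow> real \<Rightarrow> real" where
  "exercise_utility m x q S A =
     - exp (- aversion m * (notional m - x - (notional m / A - q) * S
                            - penalty m (notional m / A - q)))"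

text \<open>
  Expectation with values in \<open>[-\<infinity>, \<infinity>]\<close>. It is applied to random variables with values in
  \<open>[-\<infinity>, 0]\<close>, which need not be integrable (the Bochner integral would then be 0).
\<close>

definition ereal_expectation :: "'a measure \<Rightarrow> ('a \<Rightarrow> ereal) \<Rightarrow> ereal" where
  "ereal_expectation M Y =
     enn2ereal (\<integral>\<^sup>+ \<omega>. e2ennreal (Y \<omega>) \<partial>M) - enn2ereal (\<integral>\<^sup>+ \<omega>. e2ennreal (- Y \<omega>) \<partial>M)"

text \<open>
  A strategy \<open>v\<close> is only relevant at \<open>k < \<tau> \<omega>\<close>. As this event belongs to \<open>filt m k\<close>, an adapted
  strategy stopped at \<open>\<tau>\<close> extends to one that is adapted at all indices.
\<close>

definition admissible :: "'a asr_model \<Rightarrow> nat \<Rightarrow> ((nat \<Rightarrow> 'a \<Rightarrow> real) \<times> ('a \<Rightarrow> nat)) set" where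
  "admissible m n = {(v, \<tau>).
     (\<forall>k\<in>{n..<horizon m}. v k \<in> borel_measurable (filt m k)) \<and>
     stopping_time (filt m) \<tau> \<and>
     (\<forall>\<omega>\<in>space (prob_sp m). \<tau> \<omega> \<in> (early m \<union> {horizon m}) \<inter> {n..horizon m}) \<and>
     (AE \<omega> in prob_sp m. \<forall>k. n \<le> k \<and> k < \<tau> \<omega> \<longrightarrow>
        rho_min m * volume m (Suc k) \<omega> \<le> v k \<omega> \<and> v k \<omega> \<le> rho_max m * volume m (Suc k) \<omega>)}"

definition value_function ::
  "'a asr_model \<Rightarrow> nat \<Rightarrow> real \<Rightarrow> real \<Rightarrow> real \<Rightarrow> real \<Rightarrow> ereal" where
  "value_function m n x q S A =
     (SUP (v, \<tau>)\<in>admissible m n. ereal_expectation (prob_sp m)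
        (\<lambda>\<omega>. ereal (exercise_utility m
           (cash m v n x S (\<tau> \<omega>) \<omega>) (inventory m v n q (\<tau> \<omega>) \<omega>)
           (price m n S (\<tau> \<omega>) \<omega>) (avg_price m n A S (\<tau> \<omega>) \<omega>))))"

definition continuation_value ::
  "'a asr_model \<Rightarrow> (nat \<Rightarrow> real \<Rightarrow> real \<Rightarrow> real \<Rightarrow> real \<Rightarrow> ereal) \<Rightarrow>
   nat \<Rightarrow> real \<Rightarrow> real \<Rightarrow> real \<Rightarrow> real \<Rightarrow> ereal" where
  "continuation_value m w n x q S A =
     (SUP v\<in>{v::real. AE \<omega> in prob_sp m.
            rho_min m * volume m (Suc n) \<omega> \<le> v \<and> v \<le> rho_max m * volume m (Suc n) \<omega>}.
        ereal_expectation (prob_sp m)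
          (\<lambda>\<omega>. w (Suc n)
             (cash m (\<lambda>_ _. v) n x S (Suc n) \<omega>) (inventory m (\<lambda>_ _. v) n q (Suc n) \<omega>)
             (price m n S (Suc n) \<omega>) (avg_price m n A S (Suc n) \<omega>)))"

definition solves_bellman ::
  "'a asr_model \<Rightarrow> (nat \<Rightarrow> real \<Rightarrow> real \<Rightarrow> real \<Rightarrow> real \<Rightarrow> ereal) \<Rightarrow> bool" where
  "solves_bellman m w \<longleftrightarrow> (\<forall>n\<le>horizon m. \<forall>x q S A.
     w n x q S A =
       (if n = horizon m then ereal (exercise_utility m x q S A)
        else if n \<in> early m then
          max (continuation_value m w n x q S A) (ereal (exercise_utility m x q S A))
        else continuation_value m w n x q S A))"

end

theory Submission
  imports Defs
begin

text \<open>
  Work with costs, i.e. negated utilities, in \<open>[0, \<infinity>]\<close>. Solving the Bellman equation backwards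
  gives costs \<open>bellman_cost n\<close>; along an admissible strategy the cost stopped at \<open>\<tau>\<close> increases in
  expectation, because the next noise is independent of the past and can be integrated out with
  the current state and control frozen. It stays constant for the feedback strategy that uses a
  minimiser of the expected cost and stops as soon as stopping is no worse than holding.

  The costs may be infinite and are not continuous in the controlled variables, so measurable
  minimisers come from lower semicontinuity: each cost is an increasing limit of bounded Borel
  functions that are continuous in \<open>(x, q)\<close>. This property survives integration over the noise,
  minima and, by compactness, infima over the control interval.
\<close>

section \<open>Normal integrands and their minimisers\<close>

text \<open>Here \<open>c\<close> is the controlled variable and \<open>z\<close> the uncontrolled
  one. Continuity of the levels in \<open>c\<close> makes \<open>f\<close> lower semicontinuous in
  \<open>c\<close>. The bound \<open>real k\<close> makes level \<open>k\<close> integrable under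
  every probability measure and serves as the dominating constant, even where \<open>f\<close> is
  infinite.\<close>

definition normal_integrand ::
  "('c::euclidean_space \<times> 'z::euclidean_space \<Rightarrow> ennreal) \<Rightarrow> bool" where
  "normal_integrand f \<longleftrightarrow> (\<exists>h :: nat \<Rightarrow> 'c \<times> 'z \<Rightarrow> real.
     (\<forall>k. h k \<in> borel_measurable borel) \<and>
     (\<forall>k y. 0 \<le> h k y \<and> h k y \<le> real k) \<and>
     (\<forall>y. incseq (\<lambda>k. h k y)) \<and>
     (\<forall>k z. continuous_on UNIV (\<lambda>c. h k (c, z))) \<and>
     (\<forall>y. f y = (SUP k. ennreal (h k y))))"

lemma normal_integrand_measurable [measurable_dest]:
  assumes "normal_integrand f"
  shows "f \<in> borel_measurable borel"
proof -
  obtain h :: "nat \<Rightarrow> 'a \<times> 'b \<Rightarrow> real" where [measurable]: "\<And>k. h k \<in> borel_measurable borel"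
    and f: "\<And>y. f y = (SUP k. ennreal (h k y))"
    using assms unfolding normal_integrand_def by blast
  have "f = (\<lambda>y. SUP k. ennreal (h k y))" using f by blast
  then show ?thesis by simp
qed

text \<open>Truncation at level \<open>k\<close> preserves continuity in \<open>c\<close>, and every
  real value lies below some level.\<close>

lemma normal_integrandI_continuous:
  fixes g :: "'c::euclidean_space \<times> 'z::euclidean_space \<Rightarrow> real"
  assumes [measurable]: "g \<in> borel_measurable borel" and "\<And>y. 0 \<le> g y"
    and "\<And>z. continuous_on UNIV (\<lambda>c. g (c, z))"
  shows "normal_integrand (\<lambda>y. ennreal (g y))"
  unfolding normal_integrand_def
proof (intro exI[where x = "\<lambda>k y. min (g y) (real k)"] conjI allI)
  fix k z y
  show "(\<lambda>y. min (g y) (real k)) \<in> borel_measurable borel" by simp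
  show "0 \<le> min (g y) (real k)" using assms(2) by simp
  show "incseq (\<lambda>k. min (g y) (real k))" by (auto simp: incseq_def)
  show "continuous_on UNIV (\<lambda>c. min (g (c, z)) (real k))"
    by (intro continuous_intros assms(3))
  show "ennreal (g y) = (SUP k. ennreal (min (g y) (real k)))"
  proof (rule antisym)
    obtain k where "g y \<le> real k" using real_arch_simple by blast
    then show "ennreal (g y) \<le> (SUP k. ennreal (min (g y) (real k)))"
      by (intro SUP_upper2[of k]) auto
  qed (auto intro!: SUP_least ennreal_leI)
qed simp

text \<open>The approximations are combined level by level. Suprema of increasing sequences are
  limits, and \<open>min\<close> commutes with limits.\<close>

lemma normal_integrand_min:
  assumes "normal_integrand f" "normal_integrand g"
  shows "normal_integrand (\<lambda>y. min (f y) (g y))"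
proof -
  obtain h :: "nat \<Rightarrow> 'a \<times> 'b \<Rightarrow> real" where hm [measurable]: "\<And>k. h k \<in> borel_measurable borel"
    and h: "\<And>k y. 0 \<le> h k y" "\<And>k y. h k y \<le> real k" "\<And>y. incseq (\<lambda>k. h k y)"
      "\<And>k z. continuous_on UNIV (\<lambda>c. h k (c, z))" "\<And>y. f y = (SUP k. ennreal (h k y))"
    using assms(1) unfolding normal_integrand_def by blast
  obtain h' :: "nat \<Rightarrow> 'a \<times> 'b \<Rightarrow> real" where hm' [measurable]: "\<And>k. h' k \<in> borel_measurable borel"
    and h': "\<And>k y. 0 \<le> h' k y" "\<And>k y. h' k y \<le> real k" "\<And>y. incseq (\<lambda>k. h' k y)"
      "\<And>k z. continuous_on UNIV (\<lambda>c. h' k (c, z))" "\<And>y. g y = (SUP k. ennreal (h' k y))"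
    using assms(2) unfolding normal_integrand_def by blast
  show ?thesis unfolding normal_integrand_def
  proof (intro exI[where x = "\<lambda>k y. min (h k y) (h' k y)"] conjI allI)
    fix k z y
    show "(\<lambda>y. min (h k y) (h' k y)) \<in> borel_measurable borel" by simp
    show "0 \<le> min (h k y) (h' k y)" using h h' by simp
    show "min (h k y) (h' k y) \<le> real k" using h(2)[of k y] by linarith
    show "incseq (\<lambda>k. min (h k y) (h' k y))"
      using h(3) h'(3) unfolding incseq_def by (meson min.mono)
    show "continuous_on UNIV (\<lambda>c. min (h k (c, z)) (h' k (c, z)))"
      by (intro continuous_intros h h')
    have inc: "incseq (\<lambda>k. ennreal (h k y))" "incseq (\<lambda>k. ennreal (h' k y))"
      using h(3)[of y] h'(3)[of y] by (auto simp: incseq_def intro!: ennreal_leI)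
    have "(\<lambda>k. min (ennreal (h k y)) (ennreal (h' k y))) \<longlonglongrightarrow> min (f y) (g y)"
      unfolding h(5) h'(5) by (intro tendsto_min LIMSEQ_SUP inc)
    moreover have "(\<lambda>k. min (ennreal (h k y)) (ennreal (h' k y)))
        \<longlonglongrightarrow> (SUP k. min (ennreal (h k y)) (ennreal (h' k y)))"
      using inc by (intro LIMSEQ_SUP) (force simp: incseq_def intro: min.coboundedI1 min.coboundedI2)
    ultimately show "min (f y) (g y) = (SUP k. ennreal (min (h k y) (h' k y)))"
      using h h' by (simp add: LIMSEQ_unique flip: min_ennreal)
  qed
qed

text \<open>Dominated convergence keeps each level continuous in \<open>d\<close>, and monotone
  convergence exchanges the integral with the supremum over levels. Since \<open>r\<close> does not
  see \<open>d\<close>, the uncontrolled argument of \<open>h k\<close> stays fixed while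
  \<open>d\<close> varies, so mere measurability in it suffices.\<close>

lemma normal_integrand_nn_integral:
  fixes f :: "'c::euclidean_space \<times> 'z::euclidean_space \<Rightarrow> ennreal"
    and g :: "'d::euclidean_space \<times> 'z \<times> 'e::euclidean_space \<Rightarrow> 'c"
    and r :: "'z \<times> 'e \<Rightarrow> 'z"
  assumes f: "normal_integrand f" and "prob_space M" and [measurable_cong, simp]: "sets M = sets borel"
    and g: "continuous_on UNIV g" and [measurable]: "r \<in> borel_measurable borel"
  shows "normal_integrand (\<lambda>(d, z). \<integral>\<^sup>+ e. f (g (d, z, e), r (z, e)) \<partial>M)"
proof -
  interpret prob_space M by fact
  have [measurable]: "g \<in> borel_measurable borel" using g by (rule borel_measurable_continuous_onI)
  have [measurable]: "g \<in> borel \<Otimes>\<^sub>M borel \<Otimes>\<^sub>M borel \<rightarrow>\<^sub>M borel" "r \<in> borel \<Otimes>\<^sub>M borel \<rightarrow>\<^sub>M borel"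
    by (simp_all add: borel_prod)
  obtain h :: "nat \<Rightarrow> 'c \<times> 'z \<Rightarrow> real" where hm [measurable]: "\<And>k. h k \<in> borel_measurable borel"
    and h: "\<And>k y. 0 \<le> h k y" "\<And>k y. h k y \<le> real k" "\<And>y. incseq (\<lambda>k. h k y)"
      "\<And>k z. continuous_on UNIV (\<lambda>c. h k (c, z))" "\<And>y. f y = (SUP k. ennreal (h k y))"
    using f unfolding normal_integrand_def by blast
  have [measurable]: "h k \<in> borel \<Otimes>\<^sub>M borel \<rightarrow>\<^sub>M borel" for k
    by (simp add: borel_prod)
  define H where "H k y = (\<integral> e. h k (g (fst y, snd y, e), r (snd y, e)) \<partial>M)" for k y
  have int: "integrable M (\<lambda>e. h k (g (d, z, e), r (z, e)))" for k d z
    using h by (intro integrable_const_bound[where B = "real k"]) auto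
  have Hle: "H k y \<le> real k" for k y
  proof -
    have "H k y \<le> (\<integral> e. real k \<partial>M)" unfolding H_def
      using h int by (intro integral_mono) auto
    then show ?thesis by (simp add: prob_space)
  qed
  show ?thesis unfolding normal_integrand_def
  proof (intro exI[where x = H] conjI allI)
    fix k z y
    have "H k \<in> borel \<Otimes>\<^sub>M borel \<rightarrow>\<^sub>M borel" unfolding H_def by measurable
    then show "H k \<in> borel_measurable borel" by (simp add: borel_prod)
    show "0 \<le> H k y" unfolding H_def using h by (intro integral_nonneg_AE) auto
    show "H k y \<le> real k" by (rule Hle)
    show "incseq (\<lambda>k. H k y)"
      unfolding H_def incseq_def using h(3) int by (auto intro!: integral_mono simp: incseq_def)
    show "continuous_on UNIV (\<lambda>d. H k (d, z))"
      unfolding continuous_on_sequentially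
    proof (intro allI ballI impI)
      fix d :: "nat \<Rightarrow> 'd" and d0 assume "(\<forall>n. d n \<in> UNIV) \<and> d \<longlonglongrightarrow> d0"
      then have d: "d \<longlonglongrightarrow> d0" by blast
      have "(\<lambda>i. \<integral> e. h k (g (d i, z, e), r (z, e)) \<partial>M) \<longlonglongrightarrow> (\<integral> e. h k (g (d0, z, e), r (z, e)) \<partial>M)"
      proof (rule integral_dominated_convergence[where w = "\<lambda>_. real k"])
        show "AE e in M. (\<lambda>i. h k (g (d i, z, e), r (z, e))) \<longlonglongrightarrow> h k (g (d0, z, e), r (z, e))"
        proof (rule AE_I2)
          fix e
          have "(\<lambda>i. g (d i, z, e)) \<longlonglongrightarrow> g (d0, z, e)"
            using g d by (intro continuous_on_tendsto_compose[OF g] tendsto_intros) auto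
          then show "(\<lambda>i. h k (g (d i, z, e), r (z, e))) \<longlonglongrightarrow> h k (g (d0, z, e), r (z, e))"
            by (intro continuous_on_tendsto_compose[OF h(4)]) auto
        qed
      qed (use h in auto)
      then show "((\<lambda>d. H k (d, z)) \<circ> d) \<longlonglongrightarrow> H k (d0, z)" by (simp add: H_def comp_def)
    qed
    show "(case y of (d, z) \<Rightarrow> \<integral>\<^sup>+ e. f (g (d, z, e), r (z, e)) \<partial>M) = (SUP k. ennreal (H k y))"
    proof -
      obtain d z where y: "y = (d, z)" by (cases y)
      have "(\<integral>\<^sup>+ e. f (g (d, z, e), r (z, e)) \<partial>M)
          = (\<integral>\<^sup>+ e. (SUP k. ennreal (h k (g (d, z, e), r (z, e)))) \<partial>M)"
        unfolding h(5) ..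
      also have "\<dots> = (SUP k. \<integral>\<^sup>+ e. ennreal (h k (g (d, z, e), r (z, e))) \<partial>M)"
        using h(3) by (intro nn_integral_monotone_convergence_SUP)
          (auto simp: incseq_def le_fun_def intro!: ennreal_leI)
      also have "\<dots> = (SUP k. ennreal (H k y))"
        unfolding H_def y using h int by (subst nn_integral_eq_integral) auto
      finally show ?thesis by (simp add: y)
    qed
  qed
qed

text \<open>Uniform continuity on the compact set \<open>cball c0 1 \<times> {a..b}\<close> bounds
  the change of \<open>h\<close> by \<open>e\<close> for all controls at once. The bound stays
  strict for the infima because they are attained.\<close>

lemma continuous_on_INF_interval:
  fixes h :: "'c::euclidean_space \<times> real \<Rightarrow> real"
  assumes h: "continuous_on UNIV h" and "a \<le> b"
  shows "continuous_on UNIV (\<lambda>c. INF v\<in>{a..b}. h (c, v))"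
proof -
  have hv: "continuous_on {a..b} (\<lambda>v. h (c, v))" for c
    by (rule continuous_on_compose2[OF h]) (auto intro!: continuous_intros)
  have bdd: "bdd_below ((\<lambda>v. h (c, v)) ` {a..b})" for c
    by (intro bounded_imp_bdd_below compact_imp_bounded compact_continuous_image hv) simp
  have attained: "\<exists>v\<in>{a..b}. (INF v\<in>{a..b}. h (c, v)) = h (c, v)" for c
  proof -
    obtain v where v: "v \<in> {a..b}" "\<forall>u\<in>{a..b}. h (c, v) \<le> h (c, u)"
      using continuous_attains_inf[OF _ _ hv] assms(2) by force
    then have "(INF v\<in>{a..b}. h (c, v)) = h (c, v)"
      by (intro cInf_eq_minimum) auto
    then show ?thesis using v by blast
  qed
  show ?thesis
    unfolding continuous_on_iff
  proof (intro ballI allI impI)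
    fix c0 :: 'c and e :: real assume "0 < e"
    have "uniformly_continuous_on (cball c0 1 \<times> {a..b}) h"
      by (intro compact_uniformly_continuous compact_Times continuous_on_subset[OF h]) auto
    then obtain d where "d > 0" and d: "\<And>x y. x \<in> cball c0 1 \<times> {a..b} \<Longrightarrow>
        y \<in> cball c0 1 \<times> {a..b} \<Longrightarrow> dist y x < d \<Longrightarrow> dist (h y) (h x) < e"
      unfolding uniformly_continuous_on_def using \<open>0 < e\<close> by metis
    show "\<exists>d>0. \<forall>c\<in>UNIV. dist c c0 < d \<longrightarrow>
        dist (INF v\<in>{a..b}. h (c, v)) (INF v\<in>{a..b}. h (c0, v)) < e"
    proof (intro exI[of _ "min d 1"] conjI ballI impI)
      fix c assume c: "dist c c0 < min d 1"
      have close: "\<bar>h (c, v) - h (c0, v)\<bar> < e" if "v \<in> {a..b}" for v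
        using d[of "(c0, v)" "(c, v)"] c that by (simp add: dist_Pair_Pair dist_commute dist_real_def)
      obtain v where v: "v \<in> {a..b}" "(INF v\<in>{a..b}. h (c, v)) = h (c, v)"
        using attained by blast
      obtain u where u: "u \<in> {a..b}" "(INF v\<in>{a..b}. h (c0, v)) = h (c0, u)"
        using attained by blast
      \<comment> \<open>Each infimum is compared with the value at the minimiser belonging to the
        other point.\<close>
      have "h (c, v) \<le> h (c, u)" "h (c0, u) \<le> h (c0, v)"
        using cINF_lower[OF bdd u(1), of c] cINF_lower[OF bdd v(1), of c0] u v by auto
      then show "dist (INF v\<in>{a..b}. h (c, v)) (INF v\<in>{a..b}. h (c0, v)) < e"
        using close[OF u(1)] close[OF v(1)] by (simp add: u v dist_real_def)
    qed (use \<open>d > 0\<close> in auto)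
  qed
qed

text \<open>The candidate levels are the infima \<open>H k\<close> of the levels \<open>h k\<close>.
  By compactness of the interval, the supremum over \<open>k\<close> and the infimum over
  \<open>v\<close> may be exchanged; the same argument yields a minimiser.\<close>

lemma
  fixes f :: "('c::euclidean_space \<times> real) \<times> 'z::euclidean_space \<Rightarrow> ennreal"
  assumes f: "normal_integrand f" and ab: "a \<le> b"
  shows normal_integrand_INF: "normal_integrand (\<lambda>(c, z). INF v\<in>{a..b}. f ((c, v), z))"
    and normal_integrand_INF_attained:
      "\<exists>v\<in>{a..b}. f ((c, v), z) = (INF v\<in>{a..b}. f ((c, v), z))"
    and normal_integrand_closed_sublevel: "closed {v. f ((c, v), z) \<le> t}"
proof -
  obtain h :: "nat \<Rightarrow> ('c \<times> real) \<times> 'z \<Rightarrow> real" where hm [measurable]: "\<And>k. h k \<in> borel_measurable borel"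
    and h: "\<And>k y. 0 \<le> h k y" "\<And>k y. h k y \<le> real k" "\<And>y. incseq (\<lambda>k. h k y)"
      "\<And>k z. continuous_on UNIV (\<lambda>c. h k (c, z))" "\<And>y. f y = (SUP k. ennreal (h k y))"
    using f unfolding normal_integrand_def by blast
  define H where "H k y = (INF v\<in>{a..b}. h k ((fst y, v), snd y))" for k y
  have hv: "continuous_on A (\<lambda>v. h k ((c, v), z))" for A k c z
    by (rule continuous_on_compose2[OF h(4)]) (auto intro!: continuous_intros)
  have bdd: "bdd_below ((\<lambda>v. h k ((c, v), z)) ` {a..b})" for k c z
    using h by (intro bdd_belowI2) auto
  have H_lower: "H k (c, z) \<le> h k ((c, v), z)" if "v \<in> {a..b}" for k c z v
    unfolding H_def using cINF_lower[OF bdd[of k c z] that] by simp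
  have H_greatest: "t \<le> H k (c, z)" if "\<And>v. v \<in> {a..b} \<Longrightarrow> t \<le> h k ((c, v), z)" for k c z t
    unfolding H_def using ab that by (auto intro!: cINF_greatest)
  have attained: "\<exists>v\<in>{a..b}. H k (c, z) = h k ((c, v), z)" for k c z
  proof -
    obtain v where v: "v \<in> {a..b}" "\<forall>u\<in>{a..b}. h k ((c, v), z) \<le> h k ((c, u), z)"
      using continuous_attains_inf[OF compact_Icc _ hv[of "{a..b}" k c z]] ab by auto
    then have "H k (c, z) = h k ((c, v), z)"
      by (intro antisym H_lower H_greatest) auto
    then show ?thesis using v(1) by blast
  qed
  have closed_level: "closed {v. ennreal (h k ((c, v), z)) \<le> t}" for k c z t
    by (intro closed_Collect_le continuous_on_ennreal hv continuous_intros)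
  have sublevel: "{v. f ((c, v), z) \<le> t} = (\<Inter>k. {v. ennreal (h k ((c, v), z)) \<le> t})" for c z t
    by (auto simp: h(5) SUP_le_iff)
  show "closed {v. f ((c, v), z) \<le> t}"
    unfolding sublevel by (intro closed_INT ballI closed_level)
  \<comment> \<open>A minimiser of \<open>h k\<close> lies in \<open>?C k\<close>, and these compact
    sets shrink because the \<open>h k\<close> increase. At a common point every \<open>h k\<close>,
    hence also \<open>f\<close>, is at most \<open>?t\<close>.\<close>
  have ex: "\<exists>v\<in>{a..b}. f ((c, v), z) \<le> (SUP k. ennreal (H k (c, z)))" for c z
  proof -
    let ?t = "SUP k. ennreal (H k (c, z))"
    let ?C = "\<lambda>k. {a..b} \<inter> {v. ennreal (h k ((c, v), z)) \<le> ?t}"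
    have "\<Inter> (range ?C) \<noteq> {}"
    proof (rule compact_nest)
      fix k
      obtain v where "v \<in> {a..b}" "H k (c, z) = h k ((c, v), z)" using attained by blast
      then have "v \<in> ?C k" by (auto intro!: SUP_upper2[of k])
      then show "?C k \<noteq> {}" by blast
      show "compact (?C k)" using closed_level by (intro compact_Int_closed) auto
    next
      fix k l :: nat assume "k \<le> l"
      then have "ennreal (h k y) \<le> ennreal (h l y)" for y
        using h(3)[of y] by (auto intro: ennreal_leI incseqD)
      then show "?C l \<subseteq> ?C k" by (auto intro: order_trans)
    qed
    then show ?thesis using sublevel[of c z ?t] by blast
  qed
  have lower: "(SUP k. ennreal (H k (c, z))) \<le> f ((c, v), z)" if "v \<in> {a..b}" for c z v
    unfolding h(5) by (intro SUP_mono' ennreal_leI H_lower that)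
  have INF_eq: "(INF v\<in>{a..b}. f ((c, v), z)) = (SUP k. ennreal (H k (c, z)))" for c z
  proof (rule antisym)
    show "(INF v\<in>{a..b}. f ((c, v), z)) \<le> (SUP k. ennreal (H k (c, z)))"
      using ex[of c z] by (meson INF_lower2)
    show "(SUP k. ennreal (H k (c, z))) \<le> (INF v\<in>{a..b}. f ((c, v), z))"
      by (rule INF_greatest) (rule lower)
  qed
  show "\<exists>v\<in>{a..b}. f ((c, v), z) = (INF v\<in>{a..b}. f ((c, v), z))"
    using ex[of c z] lower[of _ c z] unfolding INF_eq by (blast intro: antisym)
  \<comment> \<open>By continuity in \<open>v\<close>, a lower bound on \<open>D\<close> extends to
    the whole interval. Superlevel sets of \<open>H k\<close> thus become countable intersections of
    Borel sets.\<close>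
  obtain D where D: "countable D" "D \<subseteq> {a..b}" "{a..b} \<subseteq> closure D"
    using separable by blast
  show "normal_integrand (\<lambda>(c, z). INF v\<in>{a..b}. f ((c, v), z))"
    unfolding normal_integrand_def
  proof (intro exI[where x = H] conjI allI)
    fix k z y
    show "H k \<in> borel_measurable borel"
    proof (rule borel_measurableI_ge)
      fix t
      have "{y \<in> space borel. t \<le> H k y} = (\<Inter>v\<in>D. {y \<in> space borel. t \<le> h k ((fst y, v), snd y)})"
      proof (intro set_eqI iffI)
        fix y :: "'c \<times> 'z"
        assume y: "y \<in> {y \<in> space borel. t \<le> H k y}"
        have "t \<le> h k ((fst y, v), snd y)" if "v \<in> D" for v
          using H_lower[of v k "fst y" "snd y"] D(2) that y by auto
        then show "y \<in> (\<Inter>v\<in>D. {y \<in> space borel. t \<le> h k ((fst y, v), snd y)})"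
          by simp
      next
        fix y :: "'c \<times> 'z"
        assume "y \<in> (\<Inter>v\<in>D. {y \<in> space borel. t \<le> h k ((fst y, v), snd y)})"
        then have D_ge: "t \<le> h k ((fst y, v), snd y)" if "v \<in> D" for v
          using that by blast
        have "t \<le> h k ((fst y, v), snd y)" if "v \<in> {a..b}" for v
        proof (rule continuous_ge_on_closure[where S = D and f = "\<lambda>v. h k ((fst y, v), snd y)"])
          show "v \<in> closure D" using that D(3) by blast
        qed (use hv D_ge in blast)+
        then have "t \<le> H k (fst y, snd y)" by (rule H_greatest)
        then show "y \<in> {y \<in> space borel. t \<le> H k y}" by simp
      qed
      also have "\<dots> \<in> sets borel"
      proof (cases "D = {}")
        case False
        have "{y \<in> space borel. t \<le> h k ((fst y, v), snd y)} \<in> sets borel" for v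
        proof -
          have "(\<lambda>y::'c \<times> 'z. ((fst y, v), snd y)) \<in> borel_measurable borel"
            by (intro borel_measurable_continuous_onI continuous_intros)
          from measurable_compose[OF this hm[of k]] show ?thesis
            by (intro borel_measurable_le) auto
        qed
        then show ?thesis using D(1) False by (intro sets.countable_INT') auto
      qed (use D ab in auto)
      finally show "{y \<in> space borel. t \<le> H k y} \<in> sets borel" .
    qed
    show "0 \<le> H k y" using H_greatest[of 0 k "fst y" "snd y"] h by simp
    show "H k y \<le> real k"
      using H_lower[of a k "fst y" "snd y"] h(2)[of k "((fst y, a), snd y)"] ab by simp
    show "incseq (\<lambda>k. H k y)"
      unfolding incseq_def
    proof (intro allI impI)
      fix i j :: nat assume "i \<le> j"
      then have "H i (fst y, snd y) \<le> h j ((fst y, v), snd y)" if "v \<in> {a..b}" for v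
        using H_lower[OF that] h(3) by (meson incseqD order_trans)
      then show "H i y \<le> H j y" using H_greatest[of "H i y" j "fst y" "snd y"] by simp
    qed
    show "continuous_on UNIV (\<lambda>c. H k (c, z))"
      unfolding H_def using continuous_on_INF_interval[OF h(4)[of k z] ab] by simp
    show "(case y of (c, z) \<Rightarrow> INF v\<in>{a..b}. f ((c, v), z)) = (SUP k. ennreal (H k y))"
      by (cases y) (simp add: INF_eq)
  qed
qed

text \<open>
  The least minimiser is Borel because it lies below \<open>t\<close> exactly when restricting the infimum
  to controls below \<open>t\<close> does not increase it.
\<close>

lemma normal_integrand_measurable_minimizer:
  fixes f :: "('c::euclidean_space \<times> real) \<times> 'z::euclidean_space \<Rightarrow> ennreal"
  assumes f: "normal_integrand f" and ab: "a \<le> b"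
  obtains s where "s \<in> borel_measurable borel" "\<And>y. s y \<in> {a..b}"
    "\<And>c z. f ((c, s (c, z)), z) = (INF v\<in>{a..b}. f ((c, v), z))"
proof -
  define M where "M t y = (INF v\<in>{a..t}. f ((fst y, v), snd y))" for t y
  define C where "C y = {a..b} \<inter> {v. f ((fst y, v), snd y) \<le> M b y}" for y
  define s where "s y = Inf (C y)" for y
  have C_ne: "C y \<noteq> {}" for y
    using normal_integrand_INF_attained[OF f ab, of "fst y" "snd y"] by (force simp: C_def M_def)
  have C_closed: "closed (C y)" for y
    unfolding C_def by (intro closed_Int normal_integrand_closed_sublevel[OF f ab]) simp
  have C_bdd: "bdd_below (C y)" for y by (auto simp: C_def)
  have s_in: "s y \<in> C y" for y
    unfolding s_def by (intro closed_contains_Inf C_ne C_bdd C_closed)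
  \<comment> \<open>Cutting \<open>t\<close> at \<open>b\<close> keeps the controls inside the
    interval. For \<open>t < a\<close> the sublevel set of \<open>s\<close> is empty, which is
    handled separately below.\<close>
  have le_iff: "s y \<le> t \<longleftrightarrow> M (min t b) y \<le> M b y" if at: "a \<le> t" for t y
  proof
    assume "s y \<le> t"
    with s_in[of y] have "s y \<in> {a..min t b}" "f ((fst y, s y), snd y) \<le> M b y"
      by (auto simp: C_def)
    then show "M (min t b) y \<le> M b y"
      unfolding M_def[of "min t b"] by (rule INF_lower2)
  next
    assume *: "M (min t b) y \<le> M b y"
    obtain v where "v \<in> {a..min t b}" "f ((fst y, v), snd y) = M (min t b) y"
      using normal_integrand_INF_attained[OF f, of a "min t b" "fst y" "snd y"] at ab
      unfolding M_def by auto
    then have "v \<in> C y" "v \<le> t" using * by (auto simp: C_def)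
    then show "s y \<le> t" unfolding s_def by (rule cInf_lower2[OF _ _ C_bdd])
  qed
  have M_measurable: "M t \<in> borel_measurable borel" if "a \<le> t" for t
    using normal_integrand_measurable[OF normal_integrand_INF[OF f that]]
    unfolding M_def case_prod_beta' .
  show thesis
  proof (rule that[of s])
    show "s \<in> borel_measurable borel"
    proof (rule borel_measurableI_le)
      fix t
      show "{y \<in> space borel. s y \<le> t} \<in> sets borel"
      proof (cases "a \<le> t")
        case True
        with ab have [measurable]: "M (min t b) \<in> borel_measurable borel" "M b \<in> borel_measurable borel"
          by (auto intro: M_measurable)
        show ?thesis unfolding le_iff[OF True] by measurable
      next
        case False
        have "\<not> s y \<le> t" for y using s_in[of y] False by (auto simp: C_def)
        then show ?thesis by simp
      qed
    qed
    show "s y \<in> {a..b}" for y using s_in[of y] by (auto simp: C_def)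
    show "f ((c, s (c, z)), z) = (INF v\<in>{a..b}. f ((c, v), z))" for c z
      using s_in[of "(c, z)"] by (intro antisym INF_lower) (auto simp: C_def M_def)
  qed
qed

text \<open>
  States are \<open>((x, q), (S, A))\<close>: the control acts on the first component only, in which the
  utility is continuous, whereas it jumps at \<open>A = 0\<close>.
\<close>

type_synonym asr_state = "(real \<times> real) \<times> (real \<times> real)"

section \<open>State transitions and the backward cost recursion\<close>

context asr_market
begin

abbreviation noise_law :: "nat \<Rightarrow> real measure" where
  "noise_law k \<equiv> distr (prob_sp m) borel (noise m k)"

text \<open>The volumes are constant only almost surely. Fixing the constants makes the transition a
  deterministic function of state, control and noise.\<close>

definition volume_const :: "nat \<Rightarrow> real" where
  "volume_const k = (SOME c. 0 < c \<and> (AE \<omega> in prob_sp m. volume m k \<omega> = c))"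

lemma volume_const:
  assumes "k \<in> {1..horizon m}"
  shows "0 < volume_const k" and "AE \<omega> in prob_sp m. volume m k \<omega> = volume_const k"
proof -
  have "\<exists>c. 0 < c \<and> (AE \<omega> in prob_sp m. volume m k \<omega> = c)"
    using volume_known[OF assms] by blast
  then have "0 < volume_const k \<and> (AE \<omega> in prob_sp m. volume m k \<omega> = volume_const k)"
    unfolding volume_const_def by (rule someI_ex)
  then show "0 < volume_const k" and "AE \<omega> in prob_sp m. volume m k \<omega> = volume_const k"
    by auto
qed

lemma horizon_pos: "0 < horizon m"
  using early_nonempty early_subset by fastforce

lemma early_less: "k \<in> early m \<Longrightarrow> 0 < k \<and> k < horizon m"
  using early_subset by fastforce

definition lo :: "nat \<Rightarrow> real" where "lo n = rho_min m * volume_const (Suc n)"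
definition hi :: "nat \<Rightarrow> real" where "hi n = rho_max m * volume_const (Suc n)"

lemma lo_le_hi: "n < horizon m \<Longrightarrow> lo n \<le> hi n"
  using volume_const(1)[of "Suc n"] rho_bounds unfolding lo_def hi_def
  by (intro mult_right_mono) auto

text \<open>The control is grouped with the account, so that \<open>next_account\<close> can play
  \<open>g\<close> and \<open>next_price\<close> can play \<open>r\<close> in
  \<open>normal_integrand_nn_integral\<close>.\<close>

definition next_account :: "nat \<Rightarrow> ((real \<times> real) \<times> real) \<times> (real \<times> real) \<times> real \<Rightarrow> real \<times> real" where
  "next_account n = (\<lambda>(((x, q), v), (S, A), e).
     (x + (v * (S + volat m * sqrt (dt m) * e) * dt m
           + exec_cost m (v / volume_const (Suc n)) * volume_const (Suc n) * dt m),
      q + v * dt m))"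

text \<open>The second component uses that \<open>n + 1\<close> times the new average is
  \<open>n\<close> times the old one plus the new price. This makes the average a Markovian state
  variable.\<close>

definition next_price :: "nat \<Rightarrow> (real \<times> real) \<times> real \<Rightarrow> real \<times> real" where
  "next_price n = (\<lambda>((S, A), e).
     (S + volat m * sqrt (dt m) * e,
      (real n * A + (S + volat m * sqrt (dt m) * e)) / real (Suc n)))"

definition step :: "nat \<Rightarrow> asr_state \<Rightarrow> real \<Rightarrow> real \<Rightarrow> asr_state" where
  "step n y v e = (next_account n ((fst y, v), snd y, e), next_price n (snd y, e))"

definition terminal_cost :: "asr_state \<Rightarrow> ennreal" where
  "terminal_cost = (\<lambda>((x, q), (S, A)). ennreal (- exercise_utility m x q S A))"

definition expected_cost ::
  "nat \<Rightarrow> (asr_state \<Rightarrow> ennreal) \<Rightarrow> ((real \<times> real) \<times> real) \<times> (real \<times> real) \<Rightarrow> ennreal" where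
  "expected_cost n f = (\<lambda>(d, z).
     \<integral>\<^sup>+ e. f (next_account n (d, z, e), next_price n (z, e)) \<partial>noise_law (Suc n))"

text \<open>The backward recursion in time is primitive recursive in the number of remaining
  periods.\<close>

primrec bellman_cost_rem :: "nat \<Rightarrow> asr_state \<Rightarrow> ennreal" where
  "bellman_cost_rem 0 = terminal_cost"
| "bellman_cost_rem (Suc j) = (\<lambda>y.
     let n = horizon m - Suc j;
       c = INF v\<in>{lo n..hi n}. expected_cost n (bellman_cost_rem j) ((fst y, v), snd y)
     in if n \<in> early m then min c (terminal_cost y) else c)"

definition bellman_cost :: "nat \<Rightarrow> asr_state \<Rightarrow> ennreal" where
  "bellman_cost n = bellman_cost_rem (horizon m - n)"

definition holding_cost :: "nat \<Rightarrow> asr_state \<Rightarrow> ennreal" where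
  "holding_cost n = (\<lambda>(c, z). INF v\<in>{lo n..hi n}. expected_cost n (bellman_cost (Suc n)) ((c, v), z))"

lemma bellman_cost_horizon: "bellman_cost (horizon m) = terminal_cost"
  by (simp add: bellman_cost_def)

lemma bellman_cost_less:
  assumes "n < horizon m"
  shows "bellman_cost n =
    (\<lambda>y. if n \<in> early m then min (holding_cost n y) (terminal_cost y) else holding_cost n y)"
proof -
  have *: "horizon m - n = Suc (horizon m - Suc n)" "horizon m - Suc (horizon m - Suc n) = n"
    using assms by auto
  show ?thesis
    unfolding bellman_cost_def holding_cost_def *(1) bellman_cost_rem.simps *(2)
    by (auto simp: Let_def case_prod_beta)
qed

section \<open>Regularity of the transition and of the costs\<close>

lemma continuous_exec_cost [continuous_intros]:
  assumes "continuous_on A f"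
  shows "continuous_on A (\<lambda>x. exec_cost m (f x))"
  using exec_cost assms unfolding execution_cost_function_def
  by (auto intro: continuous_on_compose2[of UNIV "exec_cost m"])

lemma continuous_next_account: "continuous_on UNIV (next_account n)"
  unfolding next_account_def case_prod_beta' divide_inverse by (intro continuous_intros)

lemma continuous_next_price: "continuous_on UNIV (next_price n)"
  unfolding next_price_def case_prod_beta' divide_inverse by (intro continuous_intros)

lemma next_price_measurable [measurable]: "next_price n \<in> borel_measurable borel"
  by (rule borel_measurable_continuous_onI) (rule continuous_next_price)

lemma step_measurable: "(\<lambda>(y, v, e). step n y v e) \<in> borel_measurable borel"
proof -
  have "continuous_on UNIV (\<lambda>(y, v, e). step n y v e)"
    unfolding step_def case_prod_beta'
    by (intro continuous_intros continuous_on_compose2[OF continuous_next_account]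
      continuous_on_compose2[OF continuous_next_price]) auto
  then show ?thesis by (rule borel_measurable_continuous_onI)
qed

lemma exercise_utility_nonpos: "exercise_utility m x q S A \<le> 0"
  by (simp add: exercise_utility_def)

lemma continuous_penalty [continuous_intros]:
  assumes "continuous_on A f"
  shows "continuous_on A (\<lambda>x. penalty m (f x))"
proof -
  obtain a b where "penalty m = (\<lambda>q. a * \<bar>q\<bar> + b * \<bar>q\<bar> ^ 3)"
    unfolding penalty_def by blast
  then show ?thesis by (auto intro!: continuous_intros assms)
qed

lemma normal_terminal_cost: "normal_integrand terminal_cost"
proof -
  let ?U = "\<lambda>y. - exercise_utility m (fst (fst y)) (snd (fst y)) (fst (snd y)) (snd (snd y))"
  have "normal_integrand (\<lambda>y. ennreal (?U y))"
  proof (rule normal_integrandI_continuous)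
    have "?U \<in> (borel \<Otimes>\<^sub>M borel) \<Otimes>\<^sub>M (borel \<Otimes>\<^sub>M borel) \<rightarrow>\<^sub>M borel"
      unfolding exercise_utility_def penalty_def by measurable
    then show "?U \<in> borel_measurable borel" by (simp add: borel_prod)
    show "continuous_on UNIV (\<lambda>c. ?U (c, z))" for z
      unfolding exercise_utility_def by (auto intro!: continuous_intros)
  qed (use exercise_utility_nonpos in auto)
  then show ?thesis by (simp add: terminal_cost_def case_prod_beta')
qed

lemma noise_measurable:
  assumes "k \<in> {1..horizon m}"
  shows "noise m k \<in> borel_measurable (prob_sp m)"
  using noise_integrable[OF assms] by simp

lemma normal_expected_cost:
  assumes "n < horizon m" "normal_integrand f"
  shows "normal_integrand (expected_cost n f)"
  unfolding expected_cost_def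
proof (rule normal_integrand_nn_integral[OF assms(2) _ _ continuous_next_account])
  show "prob_space (noise_law (Suc n))"
    using assms(1) by (intro prob_space_distr noise_measurable) auto
qed simp_all

lemma normal_holding_cost:
  assumes "n < horizon m" "normal_integrand (bellman_cost (Suc n))"
  shows "normal_integrand (holding_cost n)"
  unfolding holding_cost_def
  by (intro normal_integrand_INF normal_expected_cost assms lo_le_hi)

lemma normal_bellman_cost:
  assumes "n \<le> horizon m"
  shows "normal_integrand (bellman_cost n)"
  using assms
proof (induction rule: inc_induct)
  case base
  show ?case by (simp add: bellman_cost_horizon normal_terminal_cost)
next
  case (step n)
  then show ?case
    by (cases "n \<in> early m")
      (simp_all add: bellman_cost_less normal_holding_cost normal_integrand_min normal_terminal_cost)
qed

lemma bellman_cost_le_terminal_cost: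
  assumes "n \<in> early m \<union> {horizon m}"
  shows "bellman_cost n y \<le> terminal_cost y"
  using assms early_less[of n] by (auto simp: bellman_cost_horizon bellman_cost_less)

section \<open>Integrating out the next noise\<close>

lemma filt_measurable_mono:
  assumes "f \<in> measurable (filt m i) N" "i \<le> j"
  shows "f \<in> measurable (filt m j) N"
  using assms sets_F_mono[of i j] space_F[of i] space_F[of j] by (auto simp: measurable_def)

lemma filt_measurable_prob_sp:
  assumes "f \<in> measurable (filt m i) N"
  shows "f \<in> measurable (prob_sp m) N"
  using assms filt_le[of i] space_F[of i] by (auto simp: measurable_def)

text \<open>\<open>X\<close> is known at time \<open>n\<close> and the next noise is independent of
  \<open>filt m n\<close>, so their joint law is the product of the two laws; the claim is then
  Tonelli. Independence is checked on rectangles, which determine the product measure.\<close>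

lemma nn_integral_freeze:
  fixes X :: "'a \<Rightarrow> 'x::second_countable_topology"
  assumes n: "n < horizon m" and X: "X \<in> borel_measurable (filt m n)"
    and g [measurable]: "g \<in> borel_measurable (borel \<Otimes>\<^sub>M borel)"
  shows "(\<integral>\<^sup>+ \<omega>. g (X \<omega>, noise m (Suc n) \<omega>) \<partial>prob_sp m)
    = (\<integral>\<^sup>+ \<omega>. (\<integral>\<^sup>+ e. g (X \<omega>, e) \<partial>noise_law (Suc n)) \<partial>prob_sp m)"
proof -
  let ?e = "noise m (Suc n)"
  have [measurable]: "?e \<in> borel_measurable (prob_sp m)"
    using n by (intro noise_measurable) auto
  have [measurable]: "X \<in> borel_measurable (prob_sp m)"
    using X by (rule filt_measurable_prob_sp)
  interpret X: prob_space "distr (prob_sp m) borel X" by (rule prob_space_distr) simp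
  interpret e: prob_space "noise_law (Suc n)" by (rule prob_space_distr) simp
  have joint: "distr (prob_sp m) borel X \<Otimes>\<^sub>M noise_law (Suc n)
      = distr (prob_sp m) (borel \<Otimes>\<^sub>M borel) (\<lambda>\<omega>. (X \<omega>, ?e \<omega>))"
  proof (rule pair_measure_eqI)
    fix A B assume "A \<in> sets (distr (prob_sp m) borel X)" "B \<in> sets (noise_law (Suc n))"
    then have [measurable]: "A \<in> sets borel" "B \<in> sets borel" by auto
    have A: "X -` A \<inter> space (prob_sp m) \<in> sets (filt m n)"
      using measurable_sets[OF X, of A] space_F[of n] by simp
    have "prob ((X -` A \<inter> space (prob_sp m)) \<inter> (?e -` B \<inter> space (prob_sp m)))
        = prob (X -` A \<inter> space (prob_sp m)) * prob (?e -` B \<inter> space (prob_sp m))"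
      by (rule indep_setD[OF noise_indep_past[OF n] A]) auto
    moreover have "(\<lambda>\<omega>. (X \<omega>, ?e \<omega>)) -` (A \<times> B) \<inter> space (prob_sp m)
        = (X -` A \<inter> space (prob_sp m)) \<inter> (?e -` B \<inter> space (prob_sp m))"
      by auto
    ultimately show "emeasure (distr (prob_sp m) borel X) A * emeasure (noise_law (Suc n)) B
        = emeasure (distr (prob_sp m) (borel \<Otimes>\<^sub>M borel) (\<lambda>\<omega>. (X \<omega>, ?e \<omega>))) (A \<times> B)"
      by (simp add: emeasure_distr emeasure_eq_measure ennreal_mult)
  qed (simp_all add: X.sigma_finite_measure_axioms e.sigma_finite_measure_axioms
      cong: sets_pair_measure_cong)
  have "(\<integral>\<^sup>+ \<omega>. g (X \<omega>, ?e \<omega>) \<partial>prob_sp m)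
      = (\<integral>\<^sup>+ z. g z \<partial>distr (prob_sp m) (borel \<Otimes>\<^sub>M borel) (\<lambda>\<omega>. (X \<omega>, ?e \<omega>)))"
    by (subst nn_integral_distr) auto
  also have "\<dots> = (\<integral>\<^sup>+ x. (\<integral>\<^sup>+ e. g (x, e) \<partial>noise_law (Suc n)) \<partial>distr (prob_sp m) borel X)"
    unfolding joint[symmetric] by (subst e.nn_integral_fst) auto
  also have "\<dots> = (\<integral>\<^sup>+ \<omega>. (\<integral>\<^sup>+ e. g (X \<omega>, e) \<partial>noise_law (Suc n)) \<partial>prob_sp m)"
    by (subst nn_integral_distr) auto
  finally show ?thesis .
qed

section \<open>The state along a strategy\<close>

text \<open>Time is absolute and the state is held at \<open>y\<close> up to index \<open>n\<close>,
  so adaptedness follows by plain induction from index \<open>0\<close>. The transitions use the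
  constant volumes, hence agreement with the model processes is only almost sure.\<close>

primrec path ::
  "nat \<Rightarrow> asr_state \<Rightarrow> (nat \<Rightarrow> 'a \<Rightarrow> real) \<Rightarrow> nat \<Rightarrow> 'a \<Rightarrow> asr_state"
where
  "path n y v 0 \<omega> = y"
| "path n y v (Suc k) \<omega> =
     (if k < n then y else step k (path n y v k \<omega>) (v k \<omega>) (noise m (Suc k) \<omega>))"

lemma path_start: "k \<le> n \<Longrightarrow> path n y v k \<omega> = y"
  by (cases k) auto

lemma step_measurable_compose:
  assumes "Y \<in> borel_measurable M" "V \<in> borel_measurable M" "E \<in> borel_measurable M"
  shows "(\<lambda>\<omega>. step k (Y \<omega>) (V \<omega>) (E \<omega>)) \<in> borel_measurable M"
proof -
  have "(\<lambda>\<omega>. (Y \<omega>, V \<omega>, E \<omega>)) \<in> borel_measurable M"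
    using assms by (intro borel_measurable_Pair)
  from measurable_compose[OF this step_measurable[of k]] show ?thesis by simp
qed

lemma path_measurable:
  assumes v: "\<And>k. k \<in> {n..<horizon m} \<Longrightarrow> v k \<in> borel_measurable (filt m k)"
  shows "k \<le> horizon m \<Longrightarrow> path n y v k \<in> borel_measurable (filt m k)"
proof (induction k)
  case 0
  then show ?case by simp
next
  case (Suc k)
  show ?case
  proof (cases "k < n")
    case True
    then show ?thesis by simp
  next
    case False
    with Suc v[of k] noise_adapted[of "Suc k"] show ?thesis
      by (auto intro!: step_measurable_compose intro: filt_measurable_mono[of _ k])
  qed
qed

text \<open>Once the volumes equal their constants, \<open>step\<close> reproduces the increments of
  all four processes. Index \<open>0\<close> is singled out because division by \<open>0\<close>
  makes \<open>avg_price\<close> equal to \<open>0\<close> there, while the path still carries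
  \<open>A\<close>.\<close>

lemma path_eq:
  assumes vol: "\<forall>k\<in>{1..horizon m}. volume m k \<omega> = volume_const k"
    and k: "n \<le> k" "k \<le> horizon m"
  shows "path n ((x, q), (S, A)) v k \<omega>
    = ((cash m v n x S k \<omega>, inventory m v n q k \<omega>),
       (price m n S k \<omega>, if k = 0 then A else avg_price m n A S k \<omega>))"
  using k
proof (induction k rule: dec_induct)
  case base
  show ?case
    by (simp add: path_start cash_def inventory_def price_def avg_price_def)
next
  case (step k)
  let ?A = "if k = 0 then A else avg_price m n A S k \<omega>"
  \<comment> \<open>Multiplying by \<open>k\<close> covers both cases: for \<open>k = 0\<close> also
    \<open>n = 0\<close>, and both sides vanish.\<close>
  have "real k * ?A = real n * A + (\<Sum>j = n..<k. price m n S (Suc j) \<omega>)"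
    using step by (cases "k = 0") (auto simp: avg_price_def distrib_left)
  then have avg: "(real k * ?A + price m n S (Suc k) \<omega>) / real (Suc k) = avg_price m n A S (Suc k) \<omega>"
    using step by (simp add: avg_price_def add_divide_distrib)
  have price: "price m n S k \<omega> + volat m * sqrt (dt m) * noise m (Suc k) \<omega> = price m n S (Suc k) \<omega>"
    using step by (simp add: price_def distrib_left)
  have "path n ((x, q), (S, A)) v (Suc k) \<omega>
      = step k (path n ((x, q), (S, A)) v k \<omega>) (v k \<omega>) (noise m (Suc k) \<omega>)"
    using step by simp
  also have "\<dots> = ((cash m v n x S (Suc k) \<omega>, inventory m v n q (Suc k) \<omega>),
       (price m n S (Suc k) \<omega>, avg_price m n A S (Suc k) \<omega>))"
    using step vol
    by (simp add: step_def next_account_def next_price_def price avg[simplified])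
      (simp add: cash_def inventory_def algebra_simps)
  finally show ?case by simp
qed

lemma AE_volume: "AE \<omega> in prob_sp m. \<forall>k\<in>{1..horizon m}. volume m k \<omega> = volume_const k"
  by (intro AE_finite_allI volume_const) auto

lemma bellman_cost_measurable [measurable]:
  "n \<le> horizon m \<Longrightarrow> bellman_cost n \<in> borel_measurable borel"
  by (intro normal_integrand_measurable normal_bellman_cost)

lemma terminal_cost_measurable [measurable]: "terminal_cost \<in> borel_measurable borel"
  by (intro normal_integrand_measurable normal_terminal_cost)

lemma holding_cost_measurable [measurable]:
  "n < horizon m \<Longrightarrow> holding_cost n \<in> borel_measurable borel"
  by (intro normal_integrand_measurable normal_holding_cost normal_bellman_cost) auto

section \<open>Costs along strategies: lower bound and attainment\<close>

text \<open>This interpolates between the Bellman cost at the start (\<open>k = n\<close>) and the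
  cost of the strategy (\<open>k = horizon m\<close>). At \<open>k = \<tau> \<omega>\<close> the
  Bellman cost is still used, so the exercise decision is accounted for in passing from
  \<open>k\<close> to \<open>k + 1\<close>.\<close>

definition running_cost ::
  "nat \<Rightarrow> asr_state \<Rightarrow> (nat \<Rightarrow> 'a \<Rightarrow> real) \<Rightarrow> ('a \<Rightarrow> nat) \<Rightarrow> nat \<Rightarrow> ennreal" where
  "running_cost n y v \<tau> k = (\<integral>\<^sup>+ \<omega>. (if \<tau> \<omega> < k then terminal_cost (path n y v (\<tau> \<omega>) \<omega>)
     else bellman_cost k (path n y v k \<omega>)) \<partial>prob_sp m)"

lemma admissibleD:
  assumes "(v, \<tau>) \<in> admissible m n"
  shows "\<And>k. k \<in> {n..<horizon m} \<Longrightarrow> v k \<in> borel_measurable (filt m k)"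
    and "stopping_time (filt m) \<tau>"
    and "\<And>\<omega>. \<omega> \<in> space (prob_sp m) \<Longrightarrow> \<tau> \<omega> \<in> early m \<union> {horizon m} \<and> n \<le> \<tau> \<omega> \<and> \<tau> \<omega> \<le> horizon m"
    and "AE \<omega> in prob_sp m. \<forall>k. n \<le> k \<and> k < \<tau> \<omega> \<longrightarrow> v k \<omega> \<in> {lo k..hi k}"
proof -
  have AE: "AE \<omega> in prob_sp m. \<forall>k. n \<le> k \<and> k < \<tau> \<omega> \<longrightarrow>
        rho_min m * volume m (Suc k) \<omega> \<le> v k \<omega> \<and> v k \<omega> \<le> rho_max m * volume m (Suc k) \<omega>"
    and \<tau>: "\<And>\<omega>. \<omega> \<in> space (prob_sp m) \<Longrightarrow> \<tau> \<omega> \<in> early m \<union> {horizon m} \<and> n \<le> \<tau> \<omega> \<and> \<tau> \<omega> \<le> horizon m"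
    using assms by (auto simp: admissible_def)
  show "AE \<omega> in prob_sp m. \<forall>k. n \<le> k \<and> k < \<tau> \<omega> \<longrightarrow> v k \<omega> \<in> {lo k..hi k}"
    using AE AE_volume AE_space
  proof eventually_elim
    case (elim \<omega>)
    show ?case
    proof (intro allI impI)
      fix k assume "n \<le> k \<and> k < \<tau> \<omega>"
      with elim \<tau>[of \<omega>] show "v k \<omega> \<in> {lo k..hi k}"
        by (auto simp: lo_def hi_def)
    qed
  qed
qed (use assms in \<open>auto simp: admissible_def\<close>)

lemma running_cost_start:
  assumes "(v, \<tau>) \<in> admissible m n"
  shows "running_cost n y v \<tau> n = bellman_cost n y"
proof -
  have "running_cost n y v \<tau> n = (\<integral>\<^sup>+ \<omega>. bellman_cost n y \<partial>prob_sp m)"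
    unfolding running_cost_def
  proof (rule nn_integral_cong)
    fix \<omega> assume "\<omega> \<in> space (prob_sp m)"
    with admissibleD(3)[OF assms, of \<omega>]
    show "(if \<tau> \<omega> < n then terminal_cost (path n y v (\<tau> \<omega>) \<omega>) else bellman_cost n (path n y v n \<omega>))
        = bellman_cost n y"
      by (simp add: path_start)
  qed
  then show ?thesis by (simp add: emeasure_space_1)
qed

lemma running_cost_end:
  assumes "(v, \<tau>) \<in> admissible m n"
  shows "running_cost n y v \<tau> (horizon m) = (\<integral>\<^sup>+ \<omega>. terminal_cost (path n y v (\<tau> \<omega>) \<omega>) \<partial>prob_sp m)"
  unfolding running_cost_def
proof (rule nn_integral_cong)
  fix \<omega> assume "\<omega> \<in> space (prob_sp m)"
  then have "\<tau> \<omega> < horizon m \<or> \<tau> \<omega> = horizon m"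
    using admissibleD(3)[OF assms, of \<omega>] by auto
  then show "(if \<tau> \<omega> < horizon m then terminal_cost (path n y v (\<tau> \<omega>) \<omega>)
      else bellman_cost (horizon m) (path n y v (horizon m) \<omega>)) = terminal_cost (path n y v (\<tau> \<omega>) \<omega>)"
    by (auto simp: bellman_cost_horizon)
qed

text \<open>Stopped paths no longer feel the new noise. On the paths still running, state, control
  and the event \<open>k < \<tau> \<omega>\<close> are known at time \<open>k\<close>, so
  \<open>nn_integral_freeze\<close> applies.\<close>

lemma running_cost_Suc:
  assumes adm: "(v, \<tau>) \<in> admissible m n" and k: "n \<le> k" "k < horizon m"
  shows "running_cost n y v \<tau> (Suc k) =
    (\<integral>\<^sup>+ \<omega>. (if \<tau> \<omega> \<le> k then terminal_cost (path n y v (\<tau> \<omega>) \<omega>)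
      else expected_cost k (bellman_cost (Suc k))
        ((fst (path n y v k \<omega>), v k \<omega>), snd (path n y v k \<omega>))) \<partial>prob_sp m)"
proof -
  let ?p = "\<lambda>k. path n y v k"
  let ?R = "\<lambda>\<omega>. if \<tau> \<omega> \<le> k then terminal_cost (?p (\<tau> \<omega>) \<omega>) else 0"
  \<comment> \<open>The indicator of still running is frozen together with state and control; as a
    factor in \<open>?g\<close> it removes the stopped paths.\<close>
  let ?I = "\<lambda>\<omega>. if k < \<tau> \<omega> then 1 else 0 :: real"
  let ?X = "\<lambda>\<omega>. (?p k \<omega>, v k \<omega>, ?I \<omega>)"
  let ?g = "\<lambda>((y, v, i), e). ennreal i * bellman_cost (Suc k) (step k y v e)"
  let ?c = "\<lambda>\<omega>. expected_cost k (bellman_cost (Suc k)) ((fst (?p k \<omega>), v k \<omega>), snd (?p k \<omega>))"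
  note v = admissibleD(1)[OF adm] and \<tau> = admissibleD(2)[OF adm]
  have pm: "?p j \<in> borel_measurable (prob_sp m)" if "j \<le> horizon m" for j
    by (rule filt_measurable_prob_sp[OF path_measurable[OF v that]])
  note [measurable] = terminal_cost_measurable
  have [measurable]: "Measurable.pred (prob_sp m) (\<lambda>\<omega>. \<tau> \<omega> \<le> j)" for j
    using stopping_timeD[OF \<tau>] by (rule filt_measurable_prob_sp)
  have [measurable]: "Measurable.pred (prob_sp m) (\<lambda>\<omega>. \<tau> \<omega> = j)" for j
  proof -
    have "(\<lambda>\<omega>. \<tau> \<omega> = j) = (\<lambda>\<omega>. \<tau> \<omega> \<le> j \<and> (j = 0 \<or> \<not> \<tau> \<omega> \<le> j - 1))" by (auto simp: fun_eq_iff)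
    then show ?thesis by simp
  qed
  have R: "?R \<in> borel_measurable (prob_sp m)"
  proof -
    have [measurable]: "(\<lambda>\<omega>. terminal_cost (?p j \<omega>)) \<in> borel_measurable (prob_sp m)"
      if "j \<in> {..k}" for j
      using that k pm[of j] by (intro measurable_compose[OF _ terminal_cost_measurable]) auto
    \<comment> \<open>Splitting over the finitely many values of \<open>\<tau>\<close> up to
      \<open>k\<close> replaces the random index by fixed ones.\<close>
    have R_eq: "?R = (\<lambda>\<omega>. \<Sum>j\<le>k. if \<tau> \<omega> = j then terminal_cost (?p j \<omega>) else 0)"
      by (auto simp: fun_eq_iff sum.delta)
    show ?thesis unfolding R_eq by measurable
  qed
  have X: "?X \<in> borel_measurable (filt m k)"
  proof -
    have [measurable]: "Measurable.pred (filt m k) (\<lambda>\<omega>. k < \<tau> \<omega>)"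
      using stopping_timeD2[OF \<tau>] .
    show ?thesis using k by (intro borel_measurable_Pair path_measurable v) auto
  qed
  have g: "?g \<in> borel_measurable (borel \<Otimes>\<^sub>M borel)"
  proof -
    have [measurable]: "bellman_cost (Suc k) \<in> borel_measurable borel"
      using k by (intro bellman_cost_measurable) auto
    have "(\<lambda>u :: ((asr_state \<times> real \<times> real) \<times> real).
        step k (fst (fst u)) (fst (snd (fst u))) (snd u)) \<in> borel_measurable borel"
      by (intro step_measurable_compose borel_measurable_continuous_onI continuous_intros)
    moreover have "(\<lambda>u :: ((asr_state \<times> real \<times> real) \<times> real). snd (snd (fst u)))
        \<in> borel_measurable borel"
      by (intro borel_measurable_continuous_onI continuous_intros)
    ultimately show ?thesis unfolding case_prod_beta' borel_prod by measurable
  qed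
  have meas: "(\<lambda>\<omega>. ?g (?X \<omega>, noise m (Suc k) \<omega>)) \<in> borel_measurable (prob_sp m)"
    using k by (intro measurable_compose[OF _ g] measurable_Pair filt_measurable_prob_sp[OF X]
      noise_measurable) auto
  have E: "(\<integral>\<^sup>+ e. ?g (?X \<omega>, e) \<partial>noise_law (Suc k)) = (if \<tau> \<omega> \<le> k then 0 else ?c \<omega>)" for \<omega>
    by (auto simp: expected_cost_def step_def)
  have meas': "(\<lambda>\<omega>. if \<tau> \<omega> \<le> k then 0 else ?c \<omega>) \<in> borel_measurable (prob_sp m)"
  proof -
    interpret e: prob_space "noise_law (Suc k)"
      using k by (intro prob_space_distr noise_measurable) auto
    have "(\<lambda>z. \<integral>\<^sup>+ e. ?g (z, e) \<partial>noise_law (Suc k)) \<in> borel_measurable borel"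
      using g by (intro e.borel_measurable_nn_integral) auto
    from measurable_compose[OF filt_measurable_prob_sp[OF X] this] show ?thesis unfolding E .
  qed
  have "running_cost n y v \<tau> (Suc k)
      = (\<integral>\<^sup>+ \<omega>. ?R \<omega> + ?g (?X \<omega>, noise m (Suc k) \<omega>) \<partial>prob_sp m)"
    unfolding running_cost_def using k by (intro nn_integral_cong) (auto simp: less_Suc_eq_le)
  also have "\<dots> = (\<integral>\<^sup>+ \<omega>. ?R \<omega> \<partial>prob_sp m) + (\<integral>\<^sup>+ \<omega>. (if \<tau> \<omega> \<le> k then 0 else ?c \<omega>) \<partial>prob_sp m)"
    unfolding E[symmetric] nn_integral_freeze[OF k(2) X g, symmetric]
    by (intro nn_integral_add R meas)
  also have "\<dots> = (\<integral>\<^sup>+ \<omega>. ?R \<omega> + (if \<tau> \<omega> \<le> k then 0 else ?c \<omega>) \<partial>prob_sp m)"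
    by (intro nn_integral_add[symmetric] R meas')
  also have "\<dots> = (\<integral>\<^sup>+ \<omega>. (if \<tau> \<omega> \<le> k then terminal_cost (?p (\<tau> \<omega>) \<omega>) else ?c \<omega>) \<partial>prob_sp m)"
    by (intro nn_integral_cong) auto
  finally show ?thesis .
qed

text \<open>The running cost is nondecreasing in \<open>k\<close>. Exercise at \<open>k\<close>
  happens only at a permitted index, where the Bellman cost is at most the terminal cost; continuing
  with a control in the interval costs at least the infimum.\<close>

lemma bellman_cost_lower:
  assumes adm: "(v, \<tau>) \<in> admissible m n" and "n \<le> horizon m"
  shows "bellman_cost n y \<le> (\<integral>\<^sup>+ \<omega>. terminal_cost (path n y v (\<tau> \<omega>) \<omega>) \<partial>prob_sp m)"
proof -
  have "running_cost n y v \<tau> n \<le> running_cost n y v \<tau> k" if "n \<le> k" "k \<le> horizon m" for k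
    using that
  proof (induction k rule: dec_induct)
    case (step k)
    have "running_cost n y v \<tau> k \<le> running_cost n y v \<tau> (Suc k)"
      unfolding running_cost_Suc[OF adm step(1) less_le_trans[OF lessI step(4)]]
      unfolding running_cost_def
    proof (rule nn_integral_mono_AE, use admissibleD(4)[OF adm] AE_space in eventually_elim)
      fix \<omega> assume v: "\<forall>k. n \<le> k \<and> k < \<tau> \<omega> \<longrightarrow> v k \<omega> \<in> {lo k..hi k}" and \<omega>: "\<omega> \<in> space (prob_sp m)"
      let ?Y = "path n y v k \<omega>"
      consider "\<tau> \<omega> < k" | "\<tau> \<omega> = k" | "k < \<tau> \<omega>" by linarith
      then show "(if \<tau> \<omega> < k then terminal_cost (path n y v (\<tau> \<omega>) \<omega>) else bellman_cost k ?Y)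
        \<le> (if \<tau> \<omega> \<le> k then terminal_cost (path n y v (\<tau> \<omega>) \<omega>)
           else expected_cost k (bellman_cost (Suc k)) ((fst ?Y, v k \<omega>), snd ?Y))"
      proof cases
        case 2
        then show ?thesis using admissibleD(3)[OF adm \<omega>] by (auto intro: bellman_cost_le_terminal_cost)
      next
        case 3
        have "bellman_cost k ?Y \<le> holding_cost k ?Y"
          using step by (simp add: bellman_cost_less)
        also have "\<dots> \<le> expected_cost k (bellman_cost (Suc k)) ((fst ?Y, v k \<omega>), snd ?Y)"
          unfolding holding_cost_def case_prod_beta using v 3 step(1) by (intro INF_lower) auto
        finally show ?thesis using 3 by simp
      qed simp
    qed
    then show ?case using step by (meson Suc_leD order_trans)
  qed simp
  from this[of "horizon m"] show ?thesis
    using assms by (simp add: running_cost_start running_cost_end)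
qed

text \<open>Borel minimisers give adapted feedback controls. With the stopping rule below, both
  inequalities in the proof of \<open>bellman_cost_lower\<close> become equalities, so the running
  cost is constant.\<close>

lemma bellman_cost_attained:
  assumes n: "n \<le> horizon m"
  obtains v \<tau> where "(v, \<tau>) \<in> admissible m n"
    "(\<integral>\<^sup>+ \<omega>. terminal_cost (path n y v (\<tau> \<omega>) \<omega>) \<partial>prob_sp m) = bellman_cost n y"
proof -
  \<comment> \<open>With the guard inside the existential, one minimiser can be chosen for every
    \<open>k\<close> simultaneously.\<close>
  have "\<exists>s. k < horizon m \<longrightarrow> s \<in> borel_measurable borel \<and> (\<forall>y. s y \<in> {lo k..hi k}) \<and>
      (\<forall>y. expected_cost k (bellman_cost (Suc k)) ((fst y, s y), snd y) = holding_cost k y)" for k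
  proof (cases "k < horizon m")
    case True
    then have "normal_integrand (expected_cost k (bellman_cost (Suc k)))"
      by (intro normal_expected_cost normal_bellman_cost) auto
    then obtain s where "s \<in> borel_measurable borel" "\<And>y. s y \<in> {lo k..hi k}"
      "\<And>c z. expected_cost k (bellman_cost (Suc k)) ((c, s (c, z)), z)
        = (INF v\<in>{lo k..hi k}. expected_cost k (bellman_cost (Suc k)) ((c, v), z))"
      using normal_integrand_measurable_minimizer lo_le_hi[OF True] by metis
    then show ?thesis by (auto simp: holding_cost_def intro!: exI[of _ s])
  qed auto
  then obtain s where s: "\<And>k. k < horizon m \<Longrightarrow> s k \<in> borel_measurable borel"
    "\<And>k y. k < horizon m \<Longrightarrow> s k y \<in> {lo k..hi k}"
    "\<And>k y. k < horizon m \<Longrightarrow> expected_cost k (bellman_cost (Suc k)) ((fst y, s k y), snd y) = holding_cost k y"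
    by metis
  \<comment> \<open>The control depends on the state it generates. The closed-loop state is
    therefore built first, and \<open>path_Y\<close> identifies it afterwards with the path of
    \<open>v\<close>.\<close>
  define Y where "Y = rec_nat (\<lambda>\<omega>. y) (\<lambda>k Yk \<omega>. if k < n then y
     else step k (Yk \<omega>) (s k (Yk \<omega>)) (noise m (Suc k) \<omega>))"
  have Y_0: "Y 0 = (\<lambda>\<omega>. y)" and Y_Suc: "Y (Suc k) = (\<lambda>\<omega>. if k < n then y
     else step k (Y k \<omega>) (s k (Y k \<omega>)) (noise m (Suc k) \<omega>))" for k
    by (auto simp: Y_def)
  define v where "v k \<omega> = s k (Y k \<omega>)" for k \<omega>
  \<comment> \<open>The horizon always qualifies, so the least such index exists and is at most
    \<open>horizon m\<close>.\<close>
  define stop where "stop k \<omega> \<longleftrightarrow> n \<le> k \<and> (k = horizon m \<or>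
     k \<in> early m \<and> terminal_cost (Y k \<omega>) \<le> holding_cost k (Y k \<omega>))" for k \<omega>
  define \<tau> where "\<tau> \<omega> = (LEAST k. stop k \<omega>)" for \<omega>
  have path_Y: "path n y v k \<omega> = Y k \<omega>" for k \<omega>
    by (induction k) (simp_all add: Y_0 Y_Suc v_def)
  have Y_measurable: "Y k \<in> borel_measurable (filt m k)" if "k \<le> horizon m" for k
    using that
  proof (induction k)
    case (Suc k)
    then have Yk: "Y k \<in> borel_measurable (filt m (Suc k))"
      by (auto intro: filt_measurable_mono[of _ k])
    then have "(\<lambda>\<omega>. s k (Y k \<omega>)) \<in> borel_measurable (filt m (Suc k))"
      using s(1)[of k] Suc by (intro measurable_compose[OF Yk]) auto
    then show ?case unfolding Y_Suc
      using Yk Suc noise_adapted[of "Suc k"] by (cases "k < n") (auto intro!: step_measurable_compose)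
  qed (simp add: Y_0)
  have stop_horizon: "stop (horizon m) \<omega>" for \<omega> using n by (simp add: stop_def)
  have stop_\<tau>: "stop (\<tau> \<omega>) \<omega>" for \<omega> unfolding \<tau>_def by (rule LeastI) (rule stop_horizon)
  have \<tau>_le: "stop k \<omega> \<Longrightarrow> \<tau> \<omega> \<le> k" for k \<omega> unfolding \<tau>_def by (rule Least_le)
  have stop_measurable: "Measurable.pred (filt m t) (stop k)" if "k \<le> t" for k t
  proof (cases "k \<in> early m \<and> n \<le> k")
    case True
    then have k: "k < horizon m" using early_less by blast
    have [measurable]: "Y k \<in> borel_measurable (filt m t)"
      using Y_measurable[of k] k that by (auto intro: filt_measurable_mono)
    have [measurable]: "holding_cost k \<in> borel_measurable borel"
      by (rule holding_cost_measurable[OF k])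
    show ?thesis using True unfolding stop_def by simp
  next
    case False
    then have "stop k = (\<lambda>\<omega>. n \<le> k \<and> k = horizon m)" by (auto simp: stop_def fun_eq_iff)
    then show ?thesis by simp
  qed
  have adm: "(v, \<tau>) \<in> admissible m n"
    unfolding admissible_def
  proof (intro CollectI case_prodI conjI ballI)
    fix k assume "k \<in> {n..<horizon m}"
    then show "v k \<in> borel_measurable (filt m k)"
      unfolding v_def using s(1) Y_measurable by (auto intro: measurable_compose)
  next
    show "stopping_time (filt m) \<tau>"
    proof (rule stopping_timeI)
      fix t
      \<comment> \<open>As a first hitting time, \<open>\<tau>\<close> is at most \<open>t\<close>
        on a finite union of events known at time \<open>t\<close>.\<close>
      have "(\<lambda>\<omega>. \<tau> \<omega> \<le> t) = (\<lambda>\<omega>. \<exists>k\<in>{..t}. stop k \<omega>)"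
        using stop_\<tau> \<tau>_le by (fastforce simp: fun_eq_iff intro: order_trans)
      then show "Measurable.pred (filt m t) (\<lambda>\<omega>. \<tau> \<omega> \<le> t)"
        using stop_measurable by (auto intro!: pred_intros_finite)
    qed
  next
    fix \<omega>
    show "\<tau> \<omega> \<in> (early m \<union> {horizon m}) \<inter> {n..horizon m}"
      using stop_\<tau>[of \<omega>] \<tau>_le[OF stop_horizon, of \<omega>] by (auto simp: stop_def)
  next
    show "AE \<omega> in prob_sp m. \<forall>k. n \<le> k \<and> k < \<tau> \<omega> \<longrightarrow>
        rho_min m * volume m (Suc k) \<omega> \<le> v k \<omega> \<and> v k \<omega> \<le> rho_max m * volume m (Suc k) \<omega>"
      using AE_volume
    proof eventually_elim
      case (elim \<omega>)
      show ?case
      proof (intro allI impI)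
        fix k assume "n \<le> k \<and> k < \<tau> \<omega>"
        then have "k < horizon m" using \<tau>_le[OF stop_horizon, of \<omega>] by simp
        then show "rho_min m * volume m (Suc k) \<omega> \<le> v k \<omega> \<and> v k \<omega> \<le> rho_max m * volume m (Suc k) \<omega>"
          using elim s(2)[of k "Y k \<omega>"] by (simp add: v_def lo_def hi_def)
      qed
    qed
  qed
  have "running_cost n y v \<tau> n = running_cost n y v \<tau> k" if "n \<le> k" "k \<le> horizon m" for k
    using that
  proof (induction k rule: dec_induct)
    case (step k)
    then have k: "k < horizon m" by simp
    have "running_cost n y v \<tau> k = running_cost n y v \<tau> (Suc k)"
      unfolding running_cost_Suc[OF adm step(1) k] unfolding running_cost_def path_Y
    proof (rule nn_integral_cong)
      fix \<omega>
      consider "\<tau> \<omega> < k" | "\<tau> \<omega> = k" | "k < \<tau> \<omega>" by linarith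
      then show "(if \<tau> \<omega> < k then terminal_cost (Y (\<tau> \<omega>) \<omega>) else bellman_cost k (Y k \<omega>))
        = (if \<tau> \<omega> \<le> k then terminal_cost (Y (\<tau> \<omega>) \<omega>)
           else expected_cost k (bellman_cost (Suc k)) ((fst (Y k \<omega>), v k \<omega>), snd (Y k \<omega>)))"
      proof cases
        case 2
        then show ?thesis using stop_\<tau>[of \<omega>] k by (auto simp: stop_def bellman_cost_less min_def)
      next
        case 3
        \<comment> \<open>Before \<open>\<tau>\<close>, either \<open>k\<close> is not an early
          index or exercise is strictly worse than holding; in both cases the Bellman cost is the
          holding cost.\<close>
        then have "\<not> stop k \<omega>" using \<tau>_le[of k \<omega>] by auto
        then have "bellman_cost k (Y k \<omega>) = holding_cost k (Y k \<omega>)"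
          using step(1) k by (auto simp: stop_def bellman_cost_less min_def)
        then show ?thesis using 3 k by (simp add: v_def s(3))
      qed simp
    qed
    then show ?case using step by simp
  qed simp
  from this[of "horizon m"] show thesis
    using adm n by (intro that) (simp_all add: running_cost_start running_cost_end)
qed

section \<open>From costs back to utilities and value functions\<close>

text \<open>For values in \<open>[-\<infinity>, 0]\<close> the positive part integrates to
  \<open>0\<close>, so the difference never takes the form
  \<open>\<infinity> - \<infinity>\<close>.\<close>

lemma ereal_expectation_uminus_ennreal:
  "ereal_expectation M (\<lambda>\<omega>. - enn2ereal (f \<omega>)) = - enn2ereal (\<integral>\<^sup>+ \<omega>. f \<omega> \<partial>M)"
proof -
  have "e2ennreal (- enn2ereal (f \<omega>)) = 0" for \<omega> by (simp add: e2ennreal_neg)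
  then show ?thesis by (simp add: ereal_expectation_def zero_ennreal.rep_eq)
qed

lemma exercise_utility_eq_terminal_cost:
  "ereal (exercise_utility m x q S A) = - enn2ereal (terminal_cost ((x, q), (S, A)))"
  using exercise_utility_nonpos by (simp add: terminal_cost_def)

lemma ereal_expectation_cong_AE:
  assumes "AE \<omega> in M. f \<omega> = g \<omega>"
  shows "ereal_expectation M f = ereal_expectation M g"
proof -
  have "(\<integral>\<^sup>+ \<omega>. e2ennreal (f \<omega>) \<partial>M) = (\<integral>\<^sup>+ \<omega>. e2ennreal (g \<omega>) \<partial>M)"
    "(\<integral>\<^sup>+ \<omega>. e2ennreal (- f \<omega>) \<partial>M) = (\<integral>\<^sup>+ \<omega>. e2ennreal (- g \<omega>) \<partial>M)"
    using assms by (auto intro!: nn_integral_cong_AE)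
  then show ?thesis by (simp add: ereal_expectation_def)
qed

lemma strategy_value:
  assumes adm: "(v, \<tau>) \<in> admissible m n"
  shows "ereal_expectation (prob_sp m) (\<lambda>\<omega>. ereal (exercise_utility m
      (cash m v n x S (\<tau> \<omega>) \<omega>) (inventory m v n q (\<tau> \<omega>) \<omega>)
      (price m n S (\<tau> \<omega>) \<omega>) (avg_price m n A S (\<tau> \<omega>) \<omega>)))
    = - enn2ereal (\<integral>\<^sup>+ \<omega>. terminal_cost (path n ((x, q), (S, A)) v (\<tau> \<omega>) \<omega>) \<partial>prob_sp m)"
  unfolding ereal_expectation_uminus_ennreal[symmetric]
proof (rule ereal_expectation_cong_AE, use AE_volume AE_space in eventually_elim)
  fix \<omega> assume vol: "\<forall>k\<in>{1..horizon m}. volume m k \<omega> = volume_const k" and "\<omega> \<in> space (prob_sp m)"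
  \<comment> \<open>Exercise indices are positive, so the exceptional index \<open>0\<close> of
    \<open>path_eq\<close> does not occur.\<close>
  then have "n \<le> \<tau> \<omega>" "\<tau> \<omega> \<le> horizon m" "\<tau> \<omega> \<noteq> 0"
    using admissibleD(3)[OF adm, of \<omega>] early_less[of "\<tau> \<omega>"] horizon_pos by auto
  then show "ereal (exercise_utility m
      (cash m v n x S (\<tau> \<omega>) \<omega>) (inventory m v n q (\<tau> \<omega>) \<omega>)
      (price m n S (\<tau> \<omega>) \<omega>) (avg_price m n A S (\<tau> \<omega>) \<omega>))
    = - enn2ereal (terminal_cost (path n ((x, q), (S, A)) v (\<tau> \<omega>) \<omega>))"
    by (simp add: path_eq[OF vol] exercise_utility_eq_terminal_cost)
qed

text \<open>Negation reverses the order: the lower bound on costs bounds the supremum from above,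
  and the optimal strategy attains it.\<close>

lemma value_function_eq:
  assumes n: "n \<le> horizon m"
  shows "value_function m n x q S A = - enn2ereal (bellman_cost n ((x, q), (S, A)))"
  unfolding value_function_def
proof (rule antisym)
  let ?y = "((x, q), (S, A))"
  show "(SUP (v, \<tau>)\<in>admissible m n. ereal_expectation (prob_sp m) (\<lambda>\<omega>. ereal (exercise_utility m
      (cash m v n x S (\<tau> \<omega>) \<omega>) (inventory m v n q (\<tau> \<omega>) \<omega>)
      (price m n S (\<tau> \<omega>) \<omega>) (avg_price m n A S (\<tau> \<omega>) \<omega>)))) \<le> - enn2ereal (bellman_cost n ?y)"
    using bellman_cost_lower[OF _ n]
    by (auto intro!: SUP_least simp: strategy_value less_eq_ennreal.rep_eq[symmetric])
  obtain v \<tau> where "(v, \<tau>) \<in> admissible m n"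
    "(\<integral>\<^sup>+ \<omega>. terminal_cost (path n ?y v (\<tau> \<omega>) \<omega>) \<partial>prob_sp m) = bellman_cost n ?y"
    using bellman_cost_attained[OF n] .
  then show "- enn2ereal (bellman_cost n ?y) \<le> (SUP (v, \<tau>)\<in>admissible m n.
      ereal_expectation (prob_sp m) (\<lambda>\<omega>. ereal (exercise_utility m
      (cash m v n x S (\<tau> \<omega>) \<omega>) (inventory m v n q (\<tau> \<omega>) \<omega>)
      (price m n S (\<tau> \<omega>) \<omega>) (avg_price m n A S (\<tau> \<omega>) \<omega>))))"
    by (auto intro!: SUP_upper2[of "(v, \<tau>)"] simp: strategy_value)
qed

section \<open>Solutions of the Bellman equation\<close>

lemma continuation_value_eq:
  assumes n: "n < horizon m"
    and w: "\<And>x q S A. w (Suc n) x q S A = - enn2ereal (bellman_cost (Suc n) ((x, q), (S, A)))"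
  shows "continuation_value m w n x q S A = - enn2ereal (holding_cost n ((x, q), (S, A)))"
proof -
  let ?c = "\<lambda>v. expected_cost n (bellman_cost (Suc n)) (((x, q), v), (S, A))"
  have vol: "AE \<omega> in prob_sp m. volume m (Suc n) \<omega> = volume_const (Suc n)"
    using n by (intro volume_const) auto
  \<comment> \<open>The volume may be replaced by its constant; what remains does not involve
    \<open>\<omega>\<close>, so under a probability measure it holds almost surely exactly when it
    is true.\<close>
  have "(AE \<omega> in prob_sp m. rho_min m * volume m (Suc n) \<omega> \<le> v \<and> v \<le> rho_max m * volume m (Suc n) \<omega>)
      \<longleftrightarrow> (AE \<omega> in prob_sp m. v \<in> {lo n..hi n})" for v
    by (rule eventually_subst) (use vol in \<open>eventually_elim, simp add: lo_def hi_def\<close>)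
  then have controls: "{v. AE \<omega> in prob_sp m. rho_min m * volume m (Suc n) \<omega> \<le> v \<and>
      v \<le> rho_max m * volume m (Suc n) \<omega>} = {lo n..hi n}"
    by (intro set_eqI) simp
  have "ereal_expectation (prob_sp m) (\<lambda>\<omega>. w (Suc n)
        (cash m (\<lambda>_ _. v) n x S (Suc n) \<omega>) (inventory m (\<lambda>_ _. v) n q (Suc n) \<omega>)
        (price m n S (Suc n) \<omega>) (avg_price m n A S (Suc n) \<omega>)) = - enn2ereal (?c v)" for v
  proof -
    let ?f = "\<lambda>e. bellman_cost (Suc n) (step n ((x, q), (S, A)) v e)"
    have f: "?f \<in> borel_measurable borel"
    proof (rule measurable_compose[OF _ bellman_cost_measurable])
      show "step n ((x, q), (S, A)) v \<in> borel_measurable borel"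
        by (rule step_measurable_compose) auto
    qed (use n in auto)
    have "ereal_expectation (prob_sp m) (\<lambda>\<omega>. w (Suc n)
        (cash m (\<lambda>_ _. v) n x S (Suc n) \<omega>) (inventory m (\<lambda>_ _. v) n q (Suc n) \<omega>)
        (price m n S (Suc n) \<omega>) (avg_price m n A S (Suc n) \<omega>))
      = ereal_expectation (prob_sp m) (\<lambda>\<omega>. - enn2ereal (?f (noise m (Suc n) \<omega>)))"
    proof (rule ereal_expectation_cong_AE, use AE_volume in eventually_elim)
      case (elim \<omega>)
      then show ?case
        \<comment> \<open>A path of length one under the constant control \<open>v\<close> is a
          single \<open>step\<close>.\<close>
        using path_eq[OF elim, of n "Suc n" x q S A "\<lambda>_ _. v"] n by (simp add: w path_start)
    qed
    also have "\<dots> = - enn2ereal (\<integral>\<^sup>+ \<omega>. ?f (noise m (Suc n) \<omega>) \<partial>prob_sp m)"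
      by (rule ereal_expectation_uminus_ennreal)
    also have "(\<integral>\<^sup>+ \<omega>. ?f (noise m (Suc n) \<omega>) \<partial>prob_sp m) = ?c v"
      using n f noise_measurable[of "Suc n"] by (simp add: expected_cost_def step_def nn_integral_distr)
    finally show ?thesis .
  qed
  then have "continuation_value m w n x q S A = (SUP v\<in>{lo n..hi n}. - enn2ereal (?c v))"
    unfolding continuation_value_def controls by simp
  \<comment> \<open>The existence of a minimiser gives the nontrivial inequality between the
    supremum of the negatives and the negated infimum.\<close>
  also have "\<dots> = - enn2ereal (INF v\<in>{lo n..hi n}. ?c v)"
  proof (rule antisym)
    show "(SUP v\<in>{lo n..hi n}. - enn2ereal (?c v)) \<le> - enn2ereal (INF v\<in>{lo n..hi n}. ?c v)"
      by (rule SUP_least) (auto simp: less_eq_ennreal.rep_eq[symmetric] intro: INF_lower)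
    have "normal_integrand (expected_cost n (bellman_cost (Suc n)))"
      using n by (intro normal_expected_cost normal_bellman_cost) auto
    then obtain v where "v \<in> {lo n..hi n}" "?c v = (INF v\<in>{lo n..hi n}. ?c v)"
      using normal_integrand_INF_attained lo_le_hi[OF n] by blast
    then show "- enn2ereal (INF v\<in>{lo n..hi n}. ?c v) \<le> (SUP v\<in>{lo n..hi n}. - enn2ereal (?c v))"
      by (intro SUP_upper2[of v]) auto
  qed
  finally show ?thesis by (simp add: holding_cost_def)
qed

lemma max_uminus_enn2ereal: "max (- enn2ereal a) (- enn2ereal b) = - enn2ereal (min a b)"
  by (auto simp: max_def min_def less_eq_ennreal.rep_eq)

text \<open>Backward induction determines every solution on the indices up to the horizon. The
  equivalence thus provides existence and uniqueness at once.\<close>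

lemma solves_bellman_iff:
  "solves_bellman m w \<longleftrightarrow>
     (\<forall>n\<le>horizon m. \<forall>x q S A. w n x q S A = - enn2ereal (bellman_cost n ((x, q), (S, A))))"
proof
  assume w: "solves_bellman m w"
  have "\<forall>x q S A. w n x q S A = - enn2ereal (bellman_cost n ((x, q), (S, A)))" if "n \<le> horizon m" for n
    using that
  proof (induction rule: inc_induct)
    case base
    show ?case using w
      by (auto simp: solves_bellman_def bellman_cost_horizon exercise_utility_eq_terminal_cost)
  next
    case (step n)
    then have c: "continuation_value m w n x q S A = - enn2ereal (holding_cost n ((x, q), (S, A)))" for x q S A
      by (intro continuation_value_eq) auto
    show ?case using w step
      by (auto simp: solves_bellman_def c bellman_cost_less exercise_utility_eq_terminal_cost
        max_uminus_enn2ereal)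
  qed
  then show "\<forall>n\<le>horizon m. \<forall>x q S A. w n x q S A = - enn2ereal (bellman_cost n ((x, q), (S, A)))"
    by blast
next
  assume w: "\<forall>n\<le>horizon m. \<forall>x q S A. w n x q S A = - enn2ereal (bellman_cost n ((x, q), (S, A)))"
  have c: "continuation_value m w n x q S A = - enn2ereal (holding_cost n ((x, q), (S, A)))"
    if "n < horizon m" for n x q S A
    using that w by (intro continuation_value_eq) auto
  show "solves_bellman m w"
    using w by (auto simp: solves_bellman_def c bellman_cost_less bellman_cost_horizon
      exercise_utility_eq_terminal_cost max_uminus_enn2ereal le_less)
qed

end

theorem proposition1:
  fixes m :: "'a asr_model"
  assumes "asr_market m"
  shows "(\<forall>n\<le>horizon m.
            (\<lambda>(x, q, S, A). value_function m n x q S A) \<in> borel_measurable borel) \<and>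
         solves_bellman m (value_function m) \<and>
         (\<forall>w. solves_bellman m w \<longrightarrow> (\<forall>n\<le>horizon m. w n = value_function m n))"
proof -
  interpret asr_market m by fact
  have "(\<lambda>(x, q, S, A). value_function m n x q S A) \<in> borel_measurable borel" if n: "n \<le> horizon m" for n
  proof -
    \<comment> \<open>A continuous regrouping turns the quadruple into the nested pairs on which
      \<open>bellman_cost\<close> is defined.\<close>
    have "(\<lambda>u :: real \<times> real \<times> real \<times> real. ((fst u, fst (snd u)), snd (snd u))) \<in> borel_measurable borel"
      by (intro borel_measurable_continuous_onI continuous_intros)
    from measurable_compose[OF this bellman_cost_measurable[OF n]]
    have "(\<lambda>u. - enn2ereal (bellman_cost n ((fst u, fst (snd u)), snd (snd u)))) \<in> borel_measurable borel"
      by measurable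
    then show ?thesis by (simp add: value_function_eq[OF n] case_prod_beta')
  qed
  then show ?thesis
    by (auto simp: solves_bellman_iff value_function_eq fun_eq_iff)
qed

end
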